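(* Let $f:\mathbb R^n\to[0,\infty)$, $n\ge2$, be an $L_p$-nested function, let $\varrho_s$ be a probability density on $(0,\infty)$, let $W\in\mathbb R^{n\times n}$ be an invertible matrix, and let $\boldsymbol x$ be a random vector in $\mathbb R^n$ such that $\boldsymbol y=W\boldsymbol x$ is $L_p$-nested symmetric with respect to $f$ with radial density $\varrho_s$. Then the components $z_1,\dots,z_n$ of $\boldsymbol z=\mathrm{NRF}(W\boldsymbol x,f,\varrho_s)$ are statistically independent, and each has an exponential power distribution: if $I$ is the parent of the leaf of $z_i$, then $z_i$ has density proportional to $\exp(-|z_i|^{p_I}/s_I)$ with $s_I=\left(\Gamma\left[\frac1{p_I}\right]/\Gamma\left[\frac3{p_I}\right]\right)^{p_I/2}$.
   Context: **$L_p$-nested functions.** An $L_p$-nested function $f:\mathbb R^n\to[0,\infty)$ is given by a finite rooted ordered tree whose $n$ leaves, read from left to right, correspond to the coordinates; every inner node $I$ has $\ell_I\ge 2$ children, denoted $(I,1),\dots,(I,\ell_I)$, and carries an exponent $p_I>0$. Nodes are denoted by multi-indices describing the path from the root; the root is $\emptyset$. For a node $I$, $\boldsymbol y_I$ denotes the coordinates of $\boldsymbol y$ at leaves in the subtree under $I$, and $n_I$ the number of those leaves. Put $f_I(\boldsymbol y_I)=|y_i|$ if $I$ is the leaf of $y_i$, and $f_I(\boldsymbol y_I)=\left(\sum_{k=1}^{\ell_I} f_{I,k}(\boldsymbol y_{I,k})^{p_I}\right)^{1/p_I}$ if $I$ is an inner node; $f=f_\emptyset$. **$L_p$-nested symmetric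 distribution.** A random vector is $L_p$-nested symmetric with respect to $f$ if it has a Lebesgue density depending on $\boldsymbol y$ only through $f(\boldsymbol y)$; its radial density is the density of $f(\boldsymbol y)$. **The distributions $\gamma_p(u,s)$.** $\gamma_p(u,s)$ is the distribution of $T^{1/p}$, where $T$ is Gamma distributed with shape $u$ and scale $s$. **Nested Radial Factorization (NRF).** The recursion $\mathrm{NRF}(\boldsymbol y,f,\varrho_s)$ processes the inner nodes from the root downwards. For an inner node $I$ with current source radial density $\varrho_{s,I}$ (at the root, $\varrho_{s,\emptyset}=\varrho_s$): (1) let the target radial density $\varrho_{\perp,I}$ be that of $\gamma_{p_I}\left(\frac{n_I}{p_I},s_I\right)$ with $s_I=\left(\Gamma[1/p_I]/\Gamma[3/p_I]\right)^{p_I/2}$; (2) replace the current coordinates $\boldsymbol y_I$ by $\frac{\mathcal F_{\perp,I}^{-1}(\mathcal F_{s,I}(f_I(\boldsymbol y_I)))}{f_I(\boldsymbol y_I)}\,\boldsymbol y_I$, where $\mathcal F_{s,I},\mathcal F_{\perp,I}$ are the cumulative distribution functions of $\varrho_{s,I},\varrho_{\perp,I}$; (3) for every child $(I,i)$ of $I$ that is not a leaf, apply the same procedure to the (updated) coordinates $\boldsymbol y_{I,i}$ and the function $f_{I,i}$, with source radial density $\varrho_{s,(I,i)}$ equal to that of $\gamma_{p_I}\left(\frac{n_{I,i}}{p_I},s_I\right)$. The output is the resulting vector. It is defined almost surely. *)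

theory Defs
  imports "HOL-Probability.Probability"
begin

text \<open>
  Vectors live in \<open>real ^ 'n\<close>. The leaves of a tree carry the coordinate indices, and the
  well-formedness predicate below makes the left-to-right list of leaves an enumeration of the
  index type. The multi-index of an inner node is replaced by the subtree rooted at it.
\<close>

datatype 'i lp_tree = Leaf 'i | Inner real "'i lp_tree list"

fun leaves :: "'i lp_tree \<Rightarrow> 'i list" where
  "leaves (Leaf i) = [i]"
| "leaves (Inner p ts) = concat (map leaves ts)"

fun lp_subtrees :: "'i lp_tree \<Rightarrow> 'i lp_tree set" where
  "lp_subtrees (Leaf i) = {Leaf i}"
| "lp_subtrees (Inner p ts) = insert (Inner p ts) (\<Union>t\<in>set ts. lp_subtrees t)"

definition lp_tree_wf :: "'i lp_tree \<Rightarrow> bool" where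
  "lp_tree_wf t \<longleftrightarrow>
     (\<forall>p ts. Inner p ts \<in> lp_subtrees t \<longrightarrow> p > 0 \<and> length ts \<ge> 2) \<and>
     distinct (leaves t) \<and> set (leaves t) = UNIV"

text \<open>
  \<open>lp_nested t y\<close> is \<open>f_I(y_I)\<close> for the node \<open>I\<close> at which \<open>t\<close> is rooted: it takes the whole
  vector but reads only the coordinates at the leaves of \<open>t\<close>.
\<close>

fun lp_nested :: "'n::finite lp_tree \<Rightarrow> real ^ 'n \<Rightarrow> real" where
  "lp_nested (Leaf i) y = \<bar>y $ i\<bar>"
| "lp_nested (Inner p ts) y = (\<Sum>t\<leftarrow>ts. lp_nested t y powr p) powr (1 / p)"

definition lp_nested_symmetric ::
  "'a measure \<Rightarrow> 'n::finite lp_tree \<Rightarrow> ('a \<Rightarrow> real ^ 'n) \<Rightarrow> bool" where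
  "lp_nested_symmetric M t Y \<longleftrightarrow>
     (\<exists>g :: real \<Rightarrow> real. (\<forall>r. 0 \<le> g r) \<and>
        distributed M lborel Y (\<lambda>y. ennreal (g (lp_nested t y))))"

definition has_radial_density ::
  "'a measure \<Rightarrow> 'n::finite lp_tree \<Rightarrow> ('a \<Rightarrow> real ^ 'n) \<Rightarrow> (real \<Rightarrow> real) \<Rightarrow> bool" where
  "has_radial_density M t Y \<rho> \<longleftrightarrow>
     distributed M lborel (\<lambda>\<omega>. lp_nested t (Y \<omega>)) (\<lambda>r. ennreal (\<rho> r))"

definition prob_density_on_pos :: "(real \<Rightarrow> real) \<Rightarrow> bool" where
  "prob_density_on_pos \<rho> \<longleftrightarrow>
     \<rho> \<in> borel_measurable borel \<and> (\<forall>r. 0 \<le> \<rho> r) \<and> (\<forall>r\<le>0. \<rho> r = 0) \<and>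
     (\<integral>\<^sup>+ r. ennreal (\<rho> r) \<partial>lborel) = 1"

definition gamma_density :: "real \<Rightarrow> real \<Rightarrow> real \<Rightarrow> real" where
  "gamma_density u s x =
     (if x > 0 then x powr (u - 1) * exp (- x / s) / (Gamma u * s powr u) else 0)"

definition gamma_dist :: "real \<Rightarrow> real \<Rightarrow> real \<Rightarrow> real measure" where
  "gamma_dist p u s =
     distr (density lborel (\<lambda>x. ennreal (gamma_density u s x))) borel (\<lambda>x. x powr (1 / p))"

definition exponent_scale :: "real \<Rightarrow> real" where
  "exponent_scale p = (Gamma (1 / p) / Gamma (3 / p)) powr (p / 2)"

text \<open>
  The cumulative distribution function of \<open>gamma_dist p u s\<close> maps the positive reals bijectively
  onto the open unit interval. At other arguments, and for vectors with \<open>lp_nested t y = 0\<close>, the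
  factor below is a junk value; this concerns only a null set, on which the recursion is left
  undefined in the informal account.
\<close>

definition radial_factor :: "real measure \<Rightarrow> real measure \<Rightarrow> real \<Rightarrow> real" where
  "radial_factor S T r = the_inv_into {0<..} (cdf T) (cdf S r) / r"

definition scale_leaves :: "'n::finite lp_tree \<Rightarrow> real \<Rightarrow> real ^ 'n \<Rightarrow> real ^ 'n" where
  "scale_leaves t c y = (\<chi> i. if i \<in> set (leaves t) then c * y $ i else y $ i)"

text \<open>
  Radial densities enter the recursion only through their cumulative distribution functions, so
  the recursion passes on the source radial distribution \<open>S\<close>. The children of a node have disjoint
  sets of leaves, hence the order in which they are processed is immaterial.
\<close>

fun nrf_rec :: "'n::finite lp_tree \<Rightarrow> real measure \<Rightarrow> real ^ 'n \<Rightarrow> real ^ 'n" where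
  "nrf_rec (Leaf i) S y = y"
| "nrf_rec (Inner p ts) S y =
     (let I = Inner p ts;
          T = gamma_dist p (real (length (leaves I)) / p) (exponent_scale p);
          y' = scale_leaves I (radial_factor S T (lp_nested I y)) y
      in fold (\<lambda>t. nrf_rec t (gamma_dist p (real (length (leaves t)) / p) (exponent_scale p))) ts y')"

definition NRF :: "real ^ 'n \<Rightarrow> 'n::finite lp_tree \<Rightarrow> (real \<Rightarrow> real) \<Rightarrow> real ^ 'n" where
  "NRF y t \<rho> = nrf_rec t (density lborel (\<lambda>r. ennreal (\<rho> r))) y"

end

(*
  A one-homogeneous function f makes Lebesgue measure split into a radial and a directional part:
  by scaling, the image of lborel under y |-> (f y, y / f y) is the product of n r^(n-1) dr with a
  finite measure sigma. Hence for a vector with density G (f y) the radius and the direction are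
  independent and the law of the direction does not depend on G, so a quantile transform of the
  radius changes G into any other radial profile, here c exp (- f^p / s). At an inner node with
  exponent p this profile is the product of the corresponding profiles of the children, whose
  radial laws are then exactly the source laws of the recursion. The argument also works with an
  additional factor k y of the density that does not depend on the leaves below the node; this lets
  the recursion process one child after the other on the whole space.
*)
theory Submission
  imports Defs
begin

section \<open>Power measures, gamma distributions and quantile transforms\<close>

text \<open>The source radial law at the root may leave whole intervals without mass, so its
  distribution function need not be injective. The quantile transform uses only that this law has no
  atoms; a true inverse is required of the gamma target alone, which charges every interval of
  positive reals. The factor \<open>k\<close> holds the profiles of sibling subtrees. Being constant
  along the stretching of the leaves below a node, \<open>k\<close> times Lebesgue measure has total
  mass 0 or infinity. The polar decomposition therefore rests on the mass of the unit ball of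
  \<open>f\<close>, and below the root that this mass is finite is read off from the given
  probability density. Below the root, the incoming profile has the exponent of the parent, not of
  the node itself. Such a profile again has a gamma radial law, which has to be matched with the law
  that the recursion passes down. Normalising constants along the recursion are not computed from
  integrals over the space but pinned down by total mass one; at the end this also shows that the
  one-dimensional integrals are finite.\<close>

definition power_measure :: "real \<Rightarrow> real measure" where
  "power_measure a = density lborel (\<lambda>x. ennreal (if x > 0 then a * x powr (a - 1) else 0))"

lemma sets_power_measure [simp, measurable_cong]: "sets (power_measure a) = sets borel"
  by (simp add: power_measure_def)

lemma space_power_measure [simp]: "space (power_measure a) = UNIV"
  by (simp add: power_measure_def)

lemma AE_power_measure_pos: "AE x in power_measure a. x > 0"
  unfolding power_measure_def by (subst AE_density) (auto intro!: AE_I2)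

text \<open>The factor \<open>a\<close> in the density removes every constant: the mass grows in
  \<open>r\<close> exactly as the volume of a ball of radius \<open>r\<close> in dimension
  \<open>a\<close>.\<close>

lemma emeasure_power_measure_atMost:
  assumes a: "a > 0"
  shows "emeasure (power_measure a) {..r} = ennreal (if r > 0 then r powr a else 0)"
proof (cases "r > 0")
  case True
  have "((\<lambda>x. x powr (a - 1)) has_integral (r powr (a - 1 + 1) / (a - 1 + 1))) {0..r}"
    using a True by (intro has_integral_powr_from_0) auto
  then have "((\<lambda>x. a * x powr (a - 1)) has_integral (a * (r powr a / a))) {0..r}"
    by (intro has_integral_mult_right) simp
  then have hi: "((\<lambda>x. a * x powr (a - 1)) has_integral (r powr a)) {0..r}"
    using a by simp
  have "emeasure (power_measure a) {..r}
      = (\<integral>\<^sup>+x. ennreal (if x > 0 then a * x powr (a - 1) else 0) * indicator {..r} x \<partial>lborel)"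
    unfolding power_measure_def by (subst emeasure_density) auto
  also have "\<dots> = (\<integral>\<^sup>+x. ennreal (indicator {0..r} x * (a * x powr (a - 1))) \<partial>lborel)"
    by (intro nn_integral_cong_AE AE_I[where N = "{0}"])
       (auto simp: indicator_def split: if_splits)
  also have "\<dots> = ennreal (r powr a)"
    using nn_integral_has_integral_lebesgue[OF _ hi] a by simp
  finally show ?thesis using True by simp
next
  case False
  have "emeasure (power_measure a) {..r} = emeasure (power_measure a) {}"
    using AE_power_measure_pos[of a] False by (intro emeasure_eq_AE) auto
  then show ?thesis using False by simp
qed

text \<open>Half-lines generate the Borel sets and are closed under intersection, and finiteness of
  \<open>C\<close> gives each of them finite mass.\<close>

lemma power_measure_eqI:
  assumes a: "a > 0" and N: "sets N = sets borel" and C: "C < \<infinity>"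
    and eq: "\<And>r. emeasure N {..r} = C * emeasure (power_measure a) {..r}"
  shows "N = scale_measure C (power_measure a)"
proof (rule measure_eqI_generator_eq[where \<Omega> = UNIV and E = "range atMost" and A = "\<lambda>n::nat. {..real n}"])
  show "Int_stable (range (atMost :: real \<Rightarrow> real set))"
    by (auto simp: Int_stable_def)
  show "sets N = sigma_sets UNIV (range atMost)"
    by (simp add: N borel_eq_atMost)
  show "sets (scale_measure C (power_measure a)) = sigma_sets UNIV (range atMost)"
    by (simp add: borel_eq_atMost)
  show "(\<Union>i::nat. {..real i}) = UNIV"
    by (auto intro: real_arch_simple)
  show "emeasure N {..real i} \<noteq> \<infinity>" for i
    using C by (auto simp: eq emeasure_power_measure_atMost[OF a] ennreal_mult_eq_top_iff)
qed (auto simp: eq)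

lemma sigma_finite_power_measure: "sigma_finite_measure (power_measure a)"
  unfolding power_measure_def
  by (subst sigma_finite_measure.sigma_finite_iff_density_finite[OF sigma_finite_lborel]) auto

text \<open>For positive \<open>x\<close>, \<open>x powr (1 / p) \<le> r\<close> means
  \<open>x \<le> r powr p\<close>. With \<open>u = n / p\<close>, the shape of the gamma law becomes
  the dimension \<open>n\<close>.\<close>

lemma distr_power_measure_powr:
  assumes u: "u > 0" and p: "p > 0"
  shows "distr (power_measure u) borel (\<lambda>x. x powr (1 / p)) = power_measure (p * u)"
proof -
  have "distr (power_measure u) borel (\<lambda>x. x powr (1 / p)) = scale_measure 1 (power_measure (p * u))"
  proof (rule power_measure_eqI)
    fix r :: real
    have "emeasure (distr (power_measure u) borel (\<lambda>x. x powr (1 / p))) {..r}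
        = emeasure (power_measure u) {x. x powr (1 / p) \<le> r}"
      by (subst emeasure_distr) (auto intro!: arg_cong[where f = "emeasure _"])
    also have "\<dots> = emeasure (power_measure (p * u)) {..r}"
    proof (cases "r > 0")
      case True
      have iff: "x powr (1 / p) \<le> r \<longleftrightarrow> x \<le> r powr p" if "x > 0" for x
      proof -
        have "x powr (1 / p) \<le> r \<longleftrightarrow> (x powr (1 / p)) powr p \<le> r powr p"
          using True p powr_less_mono2[of p r "x powr (1 / p)"] powr_mono2[of p "x powr (1 / p)" r]
          by (auto simp: not_le[symmetric])
        then show ?thesis using that p by (simp add: powr_powr)
      qed
      have "emeasure (power_measure u) {x. x powr (1 / p) \<le> r} = emeasure (power_measure u) {..r powr p}"
        using AE_power_measure_pos[of u] by (intro emeasure_eq_AE) (auto simp: iff)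
      then show ?thesis
        using True u p by (simp add: emeasure_power_measure_atMost powr_powr)
    next
      case False
      have "r < x powr (1 / p)" if "x > 0" for x
        using that False powr_gt_zero[of x "1 / p"] by linarith
      then have "emeasure (power_measure u) {x. x powr (1 / p) \<le> r} = emeasure (power_measure u) {}"
        using AE_power_measure_pos[of u]
        by (intro emeasure_eq_AE) (auto simp: not_le elim!: eventually_mono)
      then show ?thesis
        using False u p by (simp add: emeasure_power_measure_atMost)
    qed
    finally show "emeasure (distr (power_measure u) borel (\<lambda>x. x powr (1 / p))) {..r}
        = 1 * emeasure (power_measure (p * u)) {..r}" by simp
  qed (use u p in auto)
  then show ?thesis by simp
qed

section \<open>Gamma laws as densities against power measures\<close>

lemma gamma_density_measurable [measurable]: "gamma_density u s \<in> borel_measurable borel"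
  unfolding gamma_density_def by measurable

lemma nn_integral_gamma_density:
  assumes u: "u > 0" and s: "s > 0"
  shows "(\<integral>\<^sup>+x. ennreal (gamma_density u s x) \<partial>lborel) = 1"
proof -
  have G: "Gamma u > 0" using u by (simp add: Gamma_real_pos)
  have "(\<integral>\<^sup>+x. ennreal (gamma_density u s x) \<partial>lborel)
      = ennreal s * (\<integral>\<^sup>+x. ennreal (gamma_density u s (s * x)) \<partial>lborel)"
    using s by (subst nn_integral_real_affine[where c = s and t = 0]) auto
  also have "(\<integral>\<^sup>+x. ennreal (gamma_density u s (s * x)) \<partial>lborel)
      = (\<integral>\<^sup>+x. ennreal (1 / (s * Gamma u)) * ennreal (indicator {0..} x * x powr (u - 1) / exp x) \<partial>lborel)"
  proof (intro nn_integral_cong_AE AE_I[where N = "{0}"], safe)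
    fix x :: real
    assume ne: "ennreal (gamma_density u s (s * x))
      \<noteq> ennreal (1 / (s * Gamma u)) * ennreal (indicator {0..} x * x powr (u - 1) / exp x)"
    show "x = 0"
    proof (rule ccontr)
      assume "x \<noteq> 0"
      have "gamma_density u s (s * x) = 1 / (s * Gamma u) * (indicator {0..} x * x powr (u - 1) / exp x)"
        using \<open>x \<noteq> 0\<close> s u G
        by (auto simp: gamma_density_def indicator_def zero_less_mult_iff powr_mult powr_diff exp_minus divide_simps)
      with ne G s show False by (simp flip: ennreal_mult')
    qed
  qed auto
  also have "\<dots> = ennreal (1 / (s * Gamma u)) * ennreal (Gamma u)"
    using u by (subst nn_integral_cmult) (auto simp: Gamma_conv_nn_integral_real)
  finally show ?thesis using s G by (simp flip: ennreal_mult')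
qed

text \<open>When \<open>p * u\<close> is the number of leaves, the power measure absorbs the
  Jacobian, and what is left is the profile \<open>exp (- f^p / s)\<close> evaluated at radius
  \<open>r\<close>. The factor \<open>u\<close> in the constant offsets the one in the density of
  \<open>power_measure u\<close>.\<close>

lemma gamma_dist_eq_density:
  assumes u: "u > 0" and p: "p > 0" and s: "s > 0"
  shows "gamma_dist p u s = density (power_measure (p * u))
           (\<lambda>r. ennreal (exp (- (r powr p) / s) / (u * Gamma u * s powr u)))"
proof -
  have G: "Gamma u > 0" using u by (simp add: Gamma_real_pos)
  \<comment> \<open>Writing \<open>x\<close> as \<open>(x powr (1 / p)) powr p\<close> makes the
    density a function of the image variable, so that it passes through the push-forward.\<close>
  have "density lborel (\<lambda>x. ennreal (gamma_density u s x))
      = density (power_measure u)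
          (\<lambda>x. ennreal (exp (- ((x powr (1 / p)) powr p) / s) / (u * Gamma u * s powr u)))"
    unfolding power_measure_def using u s G p
    by (subst density_density_eq)
       (auto intro!: density_cong AE_I2 simp: gamma_density_def powr_powr simp flip: ennreal_mult')
  then show ?thesis
    unfolding gamma_dist_def
    by (simp add: density_distr flip: distr_power_measure_powr[OF u p])
qed

lemma real_distribution_gamma_dist:
  assumes u: "u > 0" and s: "s > 0"
  shows "real_distribution (gamma_dist p u s)"
proof -
  interpret prob_space "density lborel (\<lambda>x. ennreal (gamma_density u s x))"
    by (rule prob_spaceI) (simp add: emeasure_density nn_integral_gamma_density[OF u s])
  show ?thesis unfolding gamma_dist_def by (intro real_distribution_distr) simp
qed

lemma exponent_scale_pos: "p > 0 \<Longrightarrow> exponent_scale p > 0"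
  using Gamma_real_pos[of "1 / p"] Gamma_real_pos[of "3 / p"]
  by (simp add: exponent_scale_def less_imp_neq[THEN not_sym])

text \<open>Continuity comes from \<open>atomless\<close>, injectivity on the positive reals from
  \<open>strict\<close>, and the value 0 at 0 from \<open>nonpos\<close>. Together they make
  \<open>the_inv_into\<close> a true quantile function on the open unit interval.\<close>

locale positive_real_distribution = real_distribution +
  assumes atomless: "measure M {x} = 0"
    and strict: "0 < a \<Longrightarrow> a < b \<Longrightarrow> measure M {a<..b} > 0"
    and nonpos: "measure M {..0} = 0"
begin

lemma cdf_strict_mono: "0 \<le> a \<Longrightarrow> a < b \<Longrightarrow> cdf M a < cdf M b"
proof -
  assume "0 \<le> a" "a < b"
  \<comment> \<open>The assumption \<open>strict\<close> asks for a positive left end, while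
    \<open>a\<close> may be 0.\<close>
  then obtain c where c: "a < c" "c < b" using dense by blast
  then have "cdf M b - cdf M c > 0"
    using \<open>0 \<le> a\<close> strict[of c b] by (subst cdf_diff_eq) auto
  then show ?thesis using cdf_nondecreasing[of a c] c by simp
qed

lemma cdf_0: "cdf M 0 = 0"
  using nonpos by (simp add: cdf_def)

lemma inj_on_cdf: "inj_on (cdf M) {0<..}"
  by (rule linorder_inj_onI') (use cdf_strict_mono less_imp_le less_imp_neq in \<open>metis greaterThan_iff\<close>)

lemma cdf_image: "cdf M ` {0<..} = {0<..<1}"
proof safe
  fix x :: real assume x: "x > 0"
  show "cdf M x \<in> {0<..<1}"
    using x cdf_strict_mono[of 0 x] cdf_strict_mono[of x "x + 1"] cdf_bounded_prob[of "x + 1"] cdf_0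
    by auto
next
  fix q :: real assume q: "q \<in> {0<..<1}"
  \<comment> \<open>\<open>max _ 1\<close> keeps \<open>b\<close> positive, so that the intermediate
    value theorem can be applied from 0 on, where the distribution function vanishes.\<close>
  from order_tendstoD(1)[OF cdf_lim_at_top_prob, of q] q
  obtain b where b: "q < cdf M b" "b > 0"
    by (force simp: eventually_at_top_linorder dest: spec[of _ "max _ 1"]
         intro: that[of "max _ 1"])
  have "\<exists>x\<ge>0. x \<le> b \<and> cdf M x = q"
    by (rule IVT) (use b q cdf_0 atomless isCont_cdf in auto)
  then obtain x where "x \<ge> 0" "cdf M x = q" by blast
  moreover have "x \<noteq> 0" using calculation q cdf_0 by auto
  ultimately show "q \<in> cdf M ` {0<..}" by force
qed

text \<open>Outside the open unit interval the inverse is the one fixed value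
  \<open>THE y. False\<close>, so the function is monotone on each of three intervals.\<close>

lemma quantile_measurable [measurable]: "the_inv_into {0<..} (cdf M) \<in> borel_measurable borel"
proof (rule borel_measurable_piecewise_mono[where C = "{{..0}, {0<..<1}, {1..}}"])
  have undef: "the_inv_into {0<..} (cdf M) q = (THE y. False)" if "q \<notin> {0<..<1}" for q
  proof -
    have "(\<lambda>y. y \<in> {0<..} \<and> cdf M y = q) = (\<lambda>y. False)"
      using that cdf_image by blast
    then show ?thesis unfolding the_inv_into_def by (rule arg_cong)
  qed
  have mono: "mono_on {0<..<1} (the_inv_into {0<..} (cdf M))"
  proof (rule mono_onI, rule ccontr)
    fix q r :: real assume *: "q \<in> {0<..<1}" "r \<in> {0<..<1}" "q \<le> r"
      "\<not> the_inv_into {0<..} (cdf M) q \<le> the_inv_into {0<..} (cdf M) r"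
    obtain x y where xy: "x > 0" "y > 0" "q = cdf M x" "r = cdf M y"
      using * cdf_image by (metis imageE greaterThan_iff)
    with * have "y < x" by (simp add: the_inv_into_f_f[OF inj_on_cdf])
    with xy * cdf_strict_mono[of y x] show False by simp
  qed
  show "mono_on c (the_inv_into {0<..} (cdf M))" if "c \<in> {{..0}, {0<..<1}, {1..}}" for c
    using that mono by (elim insertE) (auto simp: undef mono_on_def)
qed auto

lemma quantile_le_iff:
  assumes "q \<in> {0<..<1}" "t > 0"
  shows "the_inv_into {0<..} (cdf M) q \<le> t \<longleftrightarrow> q \<le> cdf M t"
proof -
  obtain x where x: "x > 0" "q = cdf M x"
    using assms cdf_image by (metis imageE greaterThan_iff)
  then show ?thesis
    using assms(2) cdf_strict_mono[of t x] cdf_nondecreasing[of x t]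
    by (auto simp: the_inv_into_f_f[OF inj_on_cdf] not_le) force
qed

lemma quantile_pos: "q \<in> {0<..<1} \<Longrightarrow> the_inv_into {0<..} (cdf M) q > 0"
  using the_inv_into_into[OF inj_on_cdf, of q "{0<..}"] by (simp add: cdf_image)

end

text \<open>The distribution function may have flat pieces, so no inverse is available. By
  continuity and monotonicity the sublevel set is a closed half-line, and at its right end, the
  supremum, the distribution function equals \<open>q\<close>.\<close>

lemma (in real_distribution) measure_cdf_le:
  assumes atomless: "\<And>x. measure M {x} = 0" and q: "0 < q" "q < 1"
  shows "measure M {x. cdf M x \<le> q} = q"
proof -
  let ?A = "{x. cdf M x \<le> q}"
  have cont: "continuous_on UNIV (cdf M)"
    using atomless isCont_cdf by (simp add: continuous_on_eq_continuous_at)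
  have closed: "closed ?A" using closed_Collect_le[OF cont continuous_on_const] by simp
  obtain b where b: "q < cdf M b"
    using order_tendstoD(1)[OF cdf_lim_at_top_prob, of q] q
    by (auto simp: eventually_at_top_linorder)
  obtain a where a: "cdf M a < q"
    using order_tendstoD(2)[OF cdf_lim_at_bot, of q] q
    by (auto simp: eventually_at_bot_linorder)
  have ab: "a \<le> b" using a b cdf_nondecreasing[of b a] by linarith
  have "\<exists>x\<ge>a. x \<le> b \<and> cdf M x = q"
    by (rule IVT) (use a b ab atomless isCont_cdf in auto)
  then obtain r where r: "cdf M r = q" by blast
  have bdd: "bdd_above ?A"
  proof (rule bdd_aboveI)
    fix x assume "x \<in> ?A"
    then show "x \<le> b" using b cdf_nondecreasing[of b x] by force
  qed
  have Sup: "Sup ?A \<in> ?A"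
    using closed bdd r by (intro closed_contains_Sup) auto
  have "?A = {..Sup ?A}"
  proof safe
    fix x assume "cdf M x \<le> q" then show "x \<le> Sup ?A" using bdd by (intro cSup_upper) auto
  next
    fix x assume "x \<le> Sup ?A"
    then show "cdf M x \<le> q" using Sup cdf_nondecreasing[of x "Sup ?A"] by simp
  qed
  moreover have "r \<le> Sup ?A" using bdd r by (intro cSup_upper) auto
  ultimately show ?thesis
    using Sup cdf_nondecreasing[of r "Sup ?A"] r by (metis antisym cdf_def mem_Collect_eq)
qed

text \<open>Comparison with the sublevel sets at level \<open>q\<close>, whose mass is
  \<open>q\<close>: letting \<open>q\<close> tend to 0 and to 1 excludes the two end values.\<close>

lemma (in real_distribution) AE_cdf_in_unit_interval:
  assumes atomless: "\<And>x. measure M {x} = 0"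
  shows "AE x in M. cdf M x \<in> {0<..<1}"
proof -
  have [measurable]: "cdf M \<in> borel_measurable borel"
    by (intro borel_measurable_mono monoI cdf_nondecreasing)
  have "measure M {x. cdf M x \<le> 0} \<le> q" if "0 < q" "q < 1" for q
    using measure_cdf_le[OF atomless that] that
      finite_measure_mono[of "{x. cdf M x \<le> 0}" "{x. cdf M x \<le> q}"] by fastforce
  then have 0: "measure M {x. cdf M x \<le> 0} \<le> 0"
    by (intro dense_ge_bounded[of 0 1]) auto
  have "measure M {x. cdf M x < 1} \<ge> q" if "0 < q" "q < 1" for q
    using measure_cdf_le[OF atomless that] that
      finite_measure_mono[of "{x. cdf M x \<le> q}" "{x. cdf M x < 1}"] by fastforce
  then have "measure M {x. cdf M x < 1} \<ge> 1"
    by (intro dense_le_bounded[of 0 1]) auto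
  then have "measure M {x \<in> space M. cdf M x < 1} = 1"
    using measure_le_1 by (intro antisym) auto
  then have 1: "AE x in M. cdf M x < 1"
    by (intro prob_Collect_eq_1[THEN iffD1]) measurable
  have "measure M {x \<in> space M. cdf M x \<le> 0} = 0"
    using 0 measure_nonneg by (intro antisym) auto
  moreover have "{x \<in> space M. cdf M x \<le> 0} \<in> events" by measurable
  ultimately have "AE x in M. \<not> cdf M x \<le> 0"
    using prob_Collect_eq_0[of "\<lambda>x. cdf M x \<le> 0"] by blast
  with 1 show ?thesis by eventually_elim auto
qed

text \<open>The transformed value is at most \<open>t\<close> exactly when
  \<open>cdf S r \<le> cdf T t\<close>, almost surely, and this event has probability
  \<open>cdf T t\<close>.\<close>

lemma distr_quantile_cdf:
  assumes S: "real_distribution S" and S0: "\<And>x. measure S {x} = 0"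
    and T: "positive_real_distribution T"
  shows "distr S borel (\<lambda>r. the_inv_into {0<..} (cdf T) (cdf S r)) = T"
    and "AE r in S. the_inv_into {0<..} (cdf T) (cdf S r) > 0"
proof -
  interpret S: real_distribution S by fact
  interpret T: positive_real_distribution T by fact
  have [measurable]: "cdf S \<in> borel_measurable borel"
    by (intro borel_measurable_mono monoI S.cdf_nondecreasing)
  let ?\<phi> = "\<lambda>r. the_inv_into {0<..} (cdf T) (cdf S r)"
  have [measurable]: "?\<phi> \<in> borel_measurable borel"
    by (rule measurable_compose[OF _ T.quantile_measurable]) measurable
  note ae = S.AE_cdf_in_unit_interval[OF S0]
  show pos: "AE r in S. ?\<phi> r > 0"
    using ae by eventually_elim (rule T.quantile_pos)
  show "distr S borel ?\<phi> = T"
  proof (rule cdf_unique)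
    show "real_distribution (distr S borel ?\<phi>)" by (rule S.real_distribution_distr) measurable
    show "real_distribution T" by unfold_locales
    show "cdf (distr S borel ?\<phi>) = cdf T"
    proof
      fix t
      have *: "cdf (distr S borel ?\<phi>) t = measure S {r. ?\<phi> r \<le> t}"
        unfolding cdf_def[of "distr S borel ?\<phi>"]
        by (subst measure_distr) (auto intro!: arg_cong[where f = "measure _"])
      show "cdf (distr S borel ?\<phi>) t = cdf T t"
      proof (cases "t > 0")
        case True
        have "measure S {r. ?\<phi> r \<le> t} = measure S {r. cdf S r \<le> cdf T t}"
          using ae by (intro S.finite_measure_eq_AE) (auto simp: T.quantile_le_iff[OF _ True])
        also have "\<dots> = cdf T t"
          using True T.cdf_image by (intro S.measure_cdf_le[OF S0]) auto
        finally show ?thesis using * by simp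
      next
        case False
        have "measure S {r. ?\<phi> r \<le> t} = measure S {}"
          using pos by (intro S.finite_measure_eq_AE) (use False in auto)
        moreover have "cdf T t = 0"
          using False T.cdf_nondecreasing[of t 0] T.cdf_0 T.cdf_nonneg[of t] by simp
        ultimately show ?thesis using * by simp
      qed
    qed
  qed
qed

lemma emeasure_power_measure_singleton: "emeasure (power_measure a) {x} = 0"
  unfolding power_measure_def
  by (subst emeasure_density) (auto intro!: nn_integral_0_iff_AE[THEN iffD2] AE_I[where N = "{x}"])

text \<open>A strictly positive density preserves null sets, so each of the three conditions becomes
  a question about null sets of the power measure, whose masses are explicit.\<close>

lemma positive_real_distribution_gamma_dist:
  assumes u: "u > 0" and p: "p > 0" and s: "s > 0"
  shows "positive_real_distribution (gamma_dist p u s)"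
proof -
  interpret real_distribution "gamma_dist p u s"
    by (rule real_distribution_gamma_dist[OF u s])
  have pu: "p * u > 0" using u p by simp
  have G: "u * Gamma u * s powr u > 0" using u s by (simp add: Gamma_real_pos)
  have null: "emeasure (gamma_dist p u s) A = 0 \<longleftrightarrow> emeasure (power_measure (p * u)) A = 0"
    if [measurable]: "A \<in> sets borel" for A
    unfolding gamma_dist_eq_density[OF u p s]
    by (subst emeasure_density, simp, simp, subst nn_integral_0_iff_AE, simp)
       (use G in \<open>auto simp: AE_iff_measurable[OF _ refl] indicator_def Collect_conj_eq not_le\<close>)
  show ?thesis
  proof unfold_locales
    fix x show "measure (gamma_dist p u s) {x} = 0"
      using null[of "{x}"] by (simp add: measure_def emeasure_power_measure_singleton)
    show "measure (gamma_dist p u s) {..0} = 0"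
      using null[of "{..0}"] by (simp add: measure_def emeasure_power_measure_atMost[OF pu])
  next
    fix a b :: real assume ab: "0 < a" "a < b"
    have "emeasure (power_measure (p * u)) {..b}
        \<le> emeasure (power_measure (p * u)) {..a} + emeasure (power_measure (p * u)) {a<..b}"
      using ab by (intro order.trans[OF emeasure_mono emeasure_subadditive]) auto
    moreover have "a powr (p * u) < b powr (p * u)"
      using ab pu by (intro powr_less_mono2) auto
    ultimately have "emeasure (power_measure (p * u)) {a<..b} \<noteq> 0"
      using ab by (auto simp: emeasure_power_measure_atMost[OF pu])
    then show "measure (gamma_dist p u s) {a<..b} > 0"
      using null[of "{a<..b}"] by (simp add: emeasure_eq_measure less_le measure_nonneg)
  qed
qed

section \<open>Polar decomposition\<close>

text \<open>The map is diagonal in the standard basis, with entries \<open>c\<close> on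
  \<open>J\<close> and 1 elsewhere. Only the leaves below one node are stretched, hence the subset
  \<open>J\<close>.\<close>

lemma nn_integral_lborel_scale_coords:
  fixes F :: "real ^ 'n::finite \<Rightarrow> ennreal"
  assumes [measurable]: "F \<in> borel_measurable borel" and c: "c > 0"
  shows "(\<integral>\<^sup>+y. F y \<partial>lborel)
      = ennreal (c ^ card J) * (\<integral>\<^sup>+y. F (\<chi> i. if i \<in> J then c * y $ i else y $ i) \<partial>lborel)"
proof -
  define a where "a b = (if b \<in> (\<lambda>i. axis i (1::real)) ` J then c else 1)" for b :: "real ^ 'n"
  have inj: "inj (\<lambda>i::'n. axis i (1::real))"
    by (auto simp: inj_on_def axis_eq_axis)
  have Basis: "(Basis :: (real ^ 'n) set) = range (\<lambda>i. axis i 1)"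
    by (auto simp: Basis_vec_def)
  have a_axis: "a (axis i 1) = (if i \<in> J then c else 1)" for i
    by (auto simp: a_def axis_eq_axis)
  have T: "0 + (\<Sum>j\<in>Basis. (a j * (y \<bullet> j)) *\<^sub>R j) = (\<chi> i. if i \<in> J then c * y $ i else y $ i)" for y
  proof -
    have "(\<Sum>j\<in>Basis. (a j * (y \<bullet> j)) *\<^sub>R j) = (\<Sum>i\<in>UNIV. (a (axis i 1) * (y \<bullet> axis i 1)) *\<^sub>R axis i 1)"
      unfolding Basis by (subst sum.reindex[OF inj]) simp
    then show ?thesis
      unfolding a_axis inner_axis
      by (simp add: vec_eq_iff axis_def if_distrib[of "\<lambda>x. _ * x"] cong: if_cong)
  qed
  have P: "(\<Prod>j\<in>Basis. \<bar>a j\<bar>) = c ^ card J"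
    unfolding Basis using c
    by (subst prod.reindex[OF inj]) (simp add: a_axis if_distrib prod.If_cases cong: if_cong)
  have "lborel = density (distr lborel borel (\<lambda>y::real^'n. 0 + (\<Sum>j\<in>Basis. (a j * (y \<bullet> j)) *\<^sub>R j)))
      (\<lambda>_. (\<Prod>j\<in>Basis. \<bar>a j\<bar>))"
    using c by (intro lborel_affine_euclidean) (auto simp: a_def)
  then have eq: "(lborel :: (real^'n) measure) =
      density (distr lborel borel (\<lambda>y. \<chi> i. if i \<in> J then c * y $ i else y $ i)) (\<lambda>_. ennreal (c ^ card J))"
    by (simp only: T P)
  have [measurable]: "(\<lambda>y::real^'n. \<chi> i. if i \<in> J then c * y $ i else y $ i) \<in> borel_measurable borel"
  proof (intro borel_measurable_continuous_onI continuous_on_vec_lambda)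
    show "continuous_on UNIV (\<lambda>y::real^'n. if i \<in> J then c * y $ i else y $ i)" for i
      by (cases "i \<in> J") (auto intro!: continuous_intros)
  qed
  show ?thesis
    by (subst eq) (simp add: nn_integral_density nn_integral_distr nn_integral_cmult)
qed

section \<open>Stretching the coordinates below a node\<close>

lemma scale_leaves_scale_leaves [simp]:
  "scale_leaves t c (scale_leaves t d y) = scale_leaves t (c * d) y"
  by (simp add: scale_leaves_def vec_eq_iff)

lemma scale_leaves_1 [simp]: "scale_leaves t 1 y = y"
  by (simp add: scale_leaves_def vec_eq_iff)

text \<open>In the recursion the factor itself depends on the vector, so joint continuity in factor
  and vector is required.\<close>

lemma measurable_scale_leaves [measurable (raw)]:
  fixes g :: "'b \<Rightarrow> real ^ 'n::finite"
  assumes c: "c \<in> borel_measurable M" and g: "g \<in> borel_measurable M"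
  shows "(\<lambda>x. scale_leaves t (c x) (g x)) \<in> borel_measurable M"
proof -
  have "continuous_on UNIV (\<lambda>z :: real \<times> (real ^ 'n). \<chi> i. if i \<in> set (leaves t) then fst z * snd z $ i else snd z $ i)"
  proof (intro continuous_on_vec_lambda)
    show "continuous_on UNIV (\<lambda>z :: real \<times> (real ^ 'n). if i \<in> set (leaves t) then fst z * snd z $ i else snd z $ i)" for i
      by (cases "i \<in> set (leaves t)") (auto intro!: continuous_intros)
  qed
  from borel_measurable_continuous_onI[OF this]
  have "(\<lambda>z. scale_leaves t (fst z) (snd z)) \<in> borel_measurable (borel \<Otimes>\<^sub>M borel)"
    by (simp add: scale_leaves_def borel_prod)
  from measurable_compose[OF measurable_Pair[OF c g] this] show ?thesis by simp
qed

text \<open>The tree \<open>t\<close> supplies the coordinates that are stretched, and the weight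
  \<open>k\<close> is constant along the stretching. The condition \<open>finite_ball\<close> makes
  the directional measure finite and prevents mass on the set where \<open>f\<close>
  vanishes.\<close>

locale radial_scaling =
  fixes t :: "'n::finite lp_tree" and f :: "real ^ 'n \<Rightarrow> real" and k :: "real ^ 'n \<Rightarrow> ennreal"
  assumes distinct: "distinct (leaves t)" and nonempty: "leaves t \<noteq> []"
    and f_measurable [measurable]: "f \<in> borel_measurable borel"
    and f_nonneg: "f y \<ge> 0"
    and f_scale: "c > 0 \<Longrightarrow> f (scale_leaves t c y) = c * f y"
    and k_measurable [measurable]: "k \<in> borel_measurable borel"
    and k_scale: "c > 0 \<Longrightarrow> k (scale_leaves t c y) = k y"
    and finite_ball: "(\<integral>\<^sup>+y. k y * indicator {y. f y \<le> 1} y \<partial>lborel) < \<infinity>"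
begin

definition m :: real where "m = real (length (leaves t))"
definition \<mu> :: "(real ^ 'n) measure" where "\<mu> = density lborel k"
definition dir :: "real ^ 'n \<Rightarrow> real ^ 'n" where "dir y = scale_leaves t (1 / f y) y"
text \<open>The directional measure is an image of the unit ball instead of a measure on its
  surface. Since \<open>power_measure m\<close> gives (0, 1] mass 1, it appears in the polar
  decomposition without a constant.\<close>

definition \<sigma> :: "(real ^ 'n) measure" where
  "\<sigma> = distr (density \<mu> (indicator {y. f y \<le> 1})) borel dir"
definition V :: ennreal where "V = emeasure \<sigma> UNIV"

lemma m_pos: "m > 0"
  using nonempty by (simp add: m_def)

lemma dir_measurable [measurable]: "dir \<in> borel_measurable borel"
  unfolding dir_def by measurable

lemma sets_\<mu> [simp, measurable_cong]: "sets \<mu> = sets borel"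
  and sets_\<sigma> [simp, measurable_cong]: "sets \<sigma> = sets borel"
  and space_\<mu> [simp]: "space \<mu> = UNIV"
  and space_\<sigma> [simp]: "space \<sigma> = UNIV"
  by (simp_all add: \<mu>_def \<sigma>_def)

lemma dir_scale: "c > 0 \<Longrightarrow> dir (scale_leaves t c y) = dir y"
  by (simp add: dir_def f_scale)

lemma emeasure_\<mu>_scale:
  assumes [measurable]: "A \<in> sets borel" and c: "c > 0"
  shows "emeasure \<mu> A = ennreal (c powr m) * emeasure \<mu> {y. scale_leaves t c y \<in> A}"
proof -
  have card: "card (set (leaves t)) = length (leaves t)"
    using distinct by (simp add: distinct_card)
  have "emeasure \<mu> A = (\<integral>\<^sup>+y. k y * indicator A y \<partial>lborel)"
    unfolding \<mu>_def by (simp add: emeasure_density)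
  also have "\<dots> = ennreal (c powr m) * (\<integral>\<^sup>+y. k (scale_leaves t c y) * indicator A (scale_leaves t c y) \<partial>lborel)"
    using c by (subst nn_integral_lborel_scale_coords[where c = c and J = "set (leaves t)"])
      (auto simp: card m_def powr_realpow scale_leaves_def)
  also have "(\<integral>\<^sup>+y. k (scale_leaves t c y) * indicator A (scale_leaves t c y) \<partial>lborel)
      = (\<integral>\<^sup>+y. k y * indicator {y. scale_leaves t c y \<in> A} y \<partial>lborel)"
    using c by (auto intro!: nn_integral_cong simp: k_scale indicator_def)
  also have "\<dots> = emeasure \<mu> {y. scale_leaves t c y \<in> A}"
    unfolding \<mu>_def by (simp add: emeasure_density)
  finally show ?thesis .
qed

lemma emeasure_\<mu>_ball: "emeasure \<mu> {y. f y \<le> 1} < \<infinity>"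
  using finite_ball by (simp add: \<mu>_def emeasure_density)

text \<open>The zero set of \<open>f\<close> is invariant under stretching by 2, which multiplies
  the measure by \<open>2 powr m > 1\<close>. As the zero set lies in the unit ball, its measure is
  finite and must be 0.\<close>

lemma AE_f_pos: "AE y in \<mu>. f y > 0"
proof -
  have Z: "{y. f y = 0} \<in> sets borel" by measurable
  have "emeasure \<mu> {y. f y = 0} \<le> emeasure \<mu> {y. f y \<le> 1}"
    by (intro emeasure_mono) auto
  then have fin: "emeasure \<mu> {y. f y = 0} < \<infinity>"
    using emeasure_\<mu>_ball by (rule le_less_trans)
  have "{y. scale_leaves t 2 y \<in> {y. f y = 0}} = {y. f y = 0}"
    by (simp add: f_scale)
  then have eq: "emeasure \<mu> {y. f y = 0} = ennreal (2 powr m) * emeasure \<mu> {y. f y = 0}"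
    using emeasure_\<mu>_scale[OF Z, of 2] by (simp only:)
  obtain x where x: "emeasure \<mu> {y. f y = 0} = ennreal x" "x \<ge> 0"
    using fin by (cases "emeasure \<mu> {y. f y = 0}") auto
  have "ennreal x = ennreal (2 powr m * x)"
    using eq x by (metis ennreal_mult powr_ge_zero)
  then have "x = 2 powr m * x"
    using x(2) by (metis ennreal_inj mult_nonneg_nonneg powr_ge_zero)
  moreover have "2 powr m > 2 powr 0"
    using m_pos by (intro powr_less_mono) auto
  ultimately have "x = 0"
    by (metis mult_cancel_right2 order_less_irrefl powr_zero_eq_one zero_neq_numeral)
  then have "{y. f y = 0} \<in> null_sets \<mu>"
    using x by (intro null_setsI) auto
  from AE_not_in[OF this] show ?thesis
    by eventually_elim (metis f_nonneg less_le mem_Collect_eq)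
qed

lemma emeasure_\<sigma>:
  "B \<in> sets borel \<Longrightarrow> emeasure \<sigma> B = emeasure \<mu> {y. f y \<le> 1 \<and> dir y \<in> B}"
  unfolding \<sigma>_def
  by (simp add: emeasure_distr emeasure_density indicator_inter_arith[symmetric] Int_def)

lemma finite_measure_\<sigma>: "finite_measure \<sigma>"
proof
  show "emeasure \<sigma> (space \<sigma>) \<noteq> \<infinity>"
    using emeasure_\<mu>_ball by (simp add: emeasure_\<sigma>)
qed

lemma V_finite: "V < \<infinity>"
  using finite_measure.emeasure_finite[OF finite_measure_\<sigma>, of UNIV]
  by (simp add: V_def less_top)

lemma sigma_finite_direction_law:
  assumes "V \<noteq> 0"
  shows "sigma_finite_measure (scale_measure (1 / V) \<sigma>)"
proof -
  interpret \<sigma>: finite_measure \<sigma> by (rule finite_measure_\<sigma>)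
  have "1 / V < \<infinity>" using assms V_finite by (cases "1 / V") (auto simp: ennreal_divide_eq_top_iff)
  then have "finite_measure (scale_measure (1 / V) \<sigma>)"
    using \<sigma>.emeasure_finite by (intro finite_measureI) (auto simp: ennreal_mult_eq_top_iff)
  then show ?thesis by (simp add: finite_measure_def)
qed

text \<open>For a fixed set \<open>B\<close> of directions, stretching by \<open>r\<close> turns the
  part of the unit ball over \<open>B\<close> into the part of the ball of radius \<open>r\<close>.
  Its mass is thus \<open>r powr m\<close> times the mass of \<open>B\<close>, and this determines
  the radial measure.\<close>

lemma polar_decomposition:
  "power_measure m \<Otimes>\<^sub>M \<sigma> = distr \<mu> (borel \<Otimes>\<^sub>M borel) (\<lambda>y. (f y, dir y))"
proof (rule pair_measure_eqI)
  interpret \<sigma>: finite_measure \<sigma> by (rule finite_measure_\<sigma>)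
  show "sigma_finite_measure \<sigma>" ..
  show "sigma_finite_measure (power_measure m)" by (rule sigma_finite_power_measure)
  show "sets (power_measure m \<Otimes>\<^sub>M \<sigma>) = sets (distr \<mu> (borel \<Otimes>\<^sub>M borel) (\<lambda>y. (f y, dir y)))"
    by (auto intro!: sets_pair_measure_cong)
  fix A B assume "A \<in> sets (power_measure m)" "B \<in> sets \<sigma>"
  then have A [measurable]: "A \<in> sets borel" and B [measurable]: "B \<in> sets borel" by auto
  define N where "N = distr (density \<mu> (indicator {y. dir y \<in> B})) borel f"
  have N: "emeasure N A = emeasure \<mu> {y. f y \<in> A \<and> dir y \<in> B}" if [measurable]: "A \<in> sets borel" for A
    unfolding N_def
    by (simp add: emeasure_distr emeasure_density indicator_inter_arith[symmetric] Int_def conj_commute)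
  have "N = scale_measure (emeasure \<sigma> B) (power_measure m)"
  proof (rule power_measure_eqI[OF m_pos])
    show "emeasure \<sigma> B < \<infinity>" by (simp add: less_top[symmetric])
    fix r
    show "emeasure N {..r} = emeasure \<sigma> B * emeasure (power_measure m) {..r}"
    proof (cases "r > 0")
      case True
      have "emeasure \<mu> {y. f y \<in> {..r} \<and> dir y \<in> B}
          = ennreal (r powr m) * emeasure \<mu> {y. scale_leaves t r y \<in> {y. f y \<in> {..r} \<and> dir y \<in> B}}"
        using True by (intro emeasure_\<mu>_scale) measurable
      also have "{y. scale_leaves t r y \<in> {y. f y \<in> {..r} \<and> dir y \<in> B}} = {y. f y \<le> 1 \<and> dir y \<in> B}"
        using True by (auto simp: f_scale dir_scale)
      finally show ?thesis
        using True by (simp add: N emeasure_\<sigma> emeasure_power_measure_atMost[OF m_pos] mult.commute)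
    next
      case False
      have "emeasure \<mu> {y. f y \<in> {..r} \<and> dir y \<in> B} = emeasure \<mu> {}"
        using AE_f_pos by (intro emeasure_eq_AE) (use False in auto)
      then show ?thesis
        using False by (simp add: N emeasure_power_measure_atMost[OF m_pos])
    qed
  qed (simp add: N_def)
  then have "emeasure \<mu> {y. f y \<in> A \<and> dir y \<in> B} = emeasure \<sigma> B * emeasure (power_measure m) A"
    using N[OF A] by simp
  moreover have "{y. f y \<in> A \<and> dir y \<in> B} = (\<lambda>y. (f y, dir y)) -` (A \<times> B) \<inter> space \<mu>" by auto
  ultimately show "emeasure (power_measure m) A * emeasure \<sigma> B
      = emeasure (distr \<mu> (borel \<Otimes>\<^sub>M borel) (\<lambda>y. (f y, dir y))) (A \<times> B)"
    by (subst emeasure_distr) (auto simp: mult.commute)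
qed

lemma emeasure_radial_density:
  assumes [measurable]: "G \<in> borel_measurable borel" "A \<in> sets borel" "B \<in> sets borel"
  shows "emeasure (density lborel (\<lambda>y. G (f y) * k y)) {y. f y \<in> A \<and> dir y \<in> B}
       = (\<integral>\<^sup>+r. G r * indicator A r \<partial>power_measure m) * emeasure \<sigma> B"
proof -
  interpret \<sigma>: finite_measure \<sigma> by (rule finite_measure_\<sigma>)
  have "emeasure (density lborel (\<lambda>y. G (f y) * k y)) {y. f y \<in> A \<and> dir y \<in> B}
      = (\<integral>\<^sup>+y. (\<lambda>(r, u). G r * indicator A r * indicator B u) (f y, dir y) \<partial>\<mu>)"
    unfolding \<mu>_def
    by (subst emeasure_density, simp, measurable, subst nn_integral_density)
       (auto intro!: nn_integral_cong simp: indicator_def ac_simps)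
  also have "\<dots> = (\<integral>\<^sup>+z. (\<lambda>(r, u). G r * indicator A r * indicator B u) z
      \<partial>distr \<mu> (borel \<Otimes>\<^sub>M borel) (\<lambda>y. (f y, dir y)))"
    by (subst nn_integral_distr) auto
  also have "\<dots> = (\<integral>\<^sup>+r. \<integral>\<^sup>+u. G r * indicator A r * indicator B u \<partial>\<sigma> \<partial>power_measure m)"
    unfolding polar_decomposition[symmetric]
    by (subst \<sigma>.nn_integral_fst[symmetric]) auto
  also have "\<dots> = (\<integral>\<^sup>+r. G r * indicator A r * emeasure \<sigma> B \<partial>power_measure m)"
    by (intro nn_integral_cong) (simp add: nn_integral_cmult)
  also have "\<dots> = (\<integral>\<^sup>+r. G r * indicator A r \<partial>power_measure m) * emeasure \<sigma> B"
    by (rule nn_integral_multc) simp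
  finally show ?thesis .
qed

lemma distr_radial_density:
  assumes [measurable]: "G \<in> borel_measurable borel"
  shows "distr (density lborel (\<lambda>y. G (f y) * k y)) borel f = density (power_measure m) (\<lambda>r. V * G r)"
proof (rule measure_eqI)
  fix A assume "A \<in> sets (distr (density lborel (\<lambda>y. G (f y) * k y)) borel f)"
  then have [measurable]: "A \<in> sets borel" by simp
  have "emeasure (distr (density lborel (\<lambda>y. G (f y) * k y)) borel f) A
      = emeasure (density lborel (\<lambda>y. G (f y) * k y)) {y. f y \<in> A \<and> dir y \<in> UNIV}"
    by (subst emeasure_distr) (auto intro!: arg_cong[where f = "emeasure _"])
  also have "\<dots> = V * (\<integral>\<^sup>+r. G r * indicator A r \<partial>power_measure m)"
    by (subst emeasure_radial_density) (auto simp: V_def mult.commute)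
  also have "\<dots> = emeasure (density (power_measure m) (\<lambda>r. V * G r)) A"
    by (simp add: emeasure_density mult.assoc nn_integral_cmult)
  finally show "emeasure (distr (density lborel (\<lambda>y. G (f y) * k y)) borel f) A
      = emeasure (density (power_measure m) (\<lambda>r. V * G r)) A" .
qed simp

text \<open>The law of the direction does not depend on the radial profile \<open>G\<close>.\<close>

lemma polar_independence:
  assumes [measurable]: "G \<in> borel_measurable borel" and V: "V \<noteq> 0"
    and N: "N = density lborel (\<lambda>y. G (f y) * k y)" and "prob_space N"
  shows "distr N borel f \<Otimes>\<^sub>M scale_measure (1 / V) \<sigma> = distr N (borel \<Otimes>\<^sub>M borel) (\<lambda>y. (f y, dir y))"
proof (rule pair_measure_eqI)
  interpret N: prob_space N by fact
  have [measurable_cong]: "sets N = sets borel" by (simp add: N)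
  have VV: "1 / V * V = 1"
    using V V_finite by (simp add: ennreal_divide_times)
  interpret fN: prob_space "distr N borel f" by (rule N.prob_space_distr) measurable
  show "sigma_finite_measure (distr N borel f)" ..
  show "sigma_finite_measure (scale_measure (1 / V) \<sigma>)"
    by (rule sigma_finite_direction_law[OF V])
  show "sets (distr N borel f \<Otimes>\<^sub>M scale_measure (1 / V) \<sigma>) = sets (distr N (borel \<Otimes>\<^sub>M borel) (\<lambda>y. (f y, dir y)))"
    by (auto intro!: sets_pair_measure_cong)
  fix A B assume "A \<in> sets (distr N borel f)" "B \<in> sets (scale_measure (1 / V) \<sigma>)"
  then have [measurable]: "A \<in> sets borel" "B \<in> sets borel" by auto
  have eq: "emeasure (distr N (borel \<Otimes>\<^sub>M borel) (\<lambda>y. (f y, dir y))) (A \<times> B)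
      = (\<integral>\<^sup>+r. G r * indicator A r \<partial>power_measure m) * emeasure \<sigma> B"
    unfolding emeasure_radial_density[symmetric, of G A B, simplified] N
    by (subst emeasure_distr) (auto intro!: arg_cong[where f = "emeasure _"])
  have "emeasure (distr N borel f) A = V * (\<integral>\<^sup>+r. G r * indicator A r \<partial>power_measure m)"
    unfolding N distr_radial_density[OF assms(1)]
    by (simp add: emeasure_density mult.assoc nn_integral_cmult)
  then have "emeasure (distr N borel f) A * emeasure (scale_measure (1 / V) \<sigma>) B
      = (1 / V * V) * ((\<integral>\<^sup>+r. G r * indicator A r \<partial>power_measure m) * emeasure \<sigma> B)"
    by (simp add: ac_simps)
  then show "emeasure (distr N borel f) A * emeasure (scale_measure (1 / V) \<sigma>) B
      = emeasure (distr N (borel \<Otimes>\<^sub>M borel) (\<lambda>y. (f y, dir y))) (A \<times> B)"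
    by (simp add: eq VV)
qed

lemma AE_radial_density_f_pos:
  "AE y in density lborel (\<lambda>y. G (f y) * k y). f y > 0"
  if [measurable]: "G \<in> borel_measurable borel"
proof -
  have "AE y in lborel. 0 < k y \<longrightarrow> 0 < f y"
    using AE_f_pos unfolding \<mu>_def by (subst (asm) AE_density) auto
  then have "AE y in lborel. 0 < G (f y) * k y \<longrightarrow> 0 < f y"
    by eventually_elim (auto simp: zero_less_iff_neq_zero)
  then show ?thesis by (simp add: AE_density)
qed

text \<open>The transform acts on the radius only, and both densities share one law of directions.
  The radial law of the new density belongs to the conclusion because it later identifies the source
  law of a child.\<close>

lemma radial_transform:
  assumes [measurable]: "G \<in> borel_measurable borel"
    and N: "N = density lborel (\<lambda>y. G (f y) * k y)" and prob: "prob_space N"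
    and p: "p > 0" and s: "s > 0"
  defines "T \<equiv> gamma_dist p (m / p) s"
  shows "\<exists>c>0. prob_space (density lborel (\<lambda>y. ennreal (c * exp (- (f y powr p) / s)) * k y)) \<and>
           distr (density lborel (\<lambda>y. ennreal (c * exp (- (f y powr p) / s)) * k y)) borel f = T \<and>
           distr N borel (\<lambda>y. scale_leaves t (radial_factor (distr N borel f) T (f y)) y)
             = density lborel (\<lambda>y. ennreal (c * exp (- (f y powr p) / s)) * k y)"
proof -
  interpret N: prob_space N by fact
  have sets_N [measurable_cong]: "sets N = sets borel" by (simp add: N)
  define u where "u = m / p"
  have u: "u > 0" and pu: "p * u = m" using m_pos p by (auto simp: u_def)
  define K where "K = u * Gamma u * s powr u"
  have K: "K > 0" using u s by (simp add: K_def Gamma_real_pos)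
  have T: "T = density (power_measure m) (\<lambda>r. ennreal (exp (- (r powr p) / s) / K))"
    unfolding T_def K_def pu[symmetric] using gamma_dist_eq_density[OF u p s] p by simp
  interpret T: positive_real_distribution T
    unfolding T_def u_def[symmetric] by (rule positive_real_distribution_gamma_dist[OF u p s])
  have S_eq: "distr N borel f = density (power_measure m) (\<lambda>r. V * G r)"
    unfolding N by (rule distr_radial_density) simp
  interpret S: real_distribution "distr N borel f"
    by (rule N.real_distribution_distr) measurable
  have V0: "V \<noteq> 0"
  proof
    assume "V = 0"
    then have "emeasure (distr N borel f) UNIV = 0" by (simp add: S_eq emeasure_density)
    then show False using S.emeasure_space_1 by simp
  qed
  obtain v where v: "V = ennreal v" "v > 0"
    using V0 V_finite by (cases V) (auto simp: less_le)
  \<comment> \<open>The new radial law has density \<open>V * c * exp (- (r powr p) / s)\<close>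
    against the power measure, and matching the constant \<open>1 / K\<close> of \<open>T\<close>
    forces this value.\<close>
  define c where "c = 1 / (K * v)"
  define h where "h r = ennreal (c * exp (- (r powr p) / s))" for r
  have [measurable]: "h \<in> borel_measurable borel" unfolding h_def by measurable
  have c: "c > 0" using K v by (simp add: c_def)
  define N' where "N' = density lborel (\<lambda>y. h (f y) * k y)"
  have sets_N' [measurable_cong]: "sets N' = sets borel" by (simp add: N'_def)
  have T': "distr N' borel f = T"
    unfolding N'_def T h_def
    by (subst distr_radial_density) (use v K in \<open>auto simp: c_def v(1) simp flip: ennreal_mult'\<close>)
  have "emeasure N' (space N') = emeasure T UNIV"
    unfolding T'[symmetric] by (subst emeasure_distr) (auto simp: N'_def)
  then have prob': "prob_space N'"
    using T.emeasure_space_1 by (intro prob_spaceI) simp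
  have S0: "measure (distr N borel f) {x} = 0" for x
  proof -
    have "AE y in power_measure m. y \<notin> {x}"
      by (rule AE_not_in) (auto intro!: null_setsI simp: emeasure_power_measure_singleton)
    then have "AE y in power_measure m. V * G y * indicator {x} y = 0"
      by eventually_elim auto
    then have "emeasure (distr N borel f) {x} = 0"
      unfolding S_eq by (subst emeasure_density, simp, simp, subst nn_integral_0_iff_AE) auto
    then show ?thesis by (simp add: measure_def)
  qed
  define \<phi> where "\<phi> r = the_inv_into {0<..} (cdf T) (cdf (distr N borel f) r)" for r
  have [measurable]: "cdf (distr N borel f) \<in> borel_measurable borel"
    by (intro borel_measurable_mono monoI S.cdf_nondecreasing)
  have \<phi>_meas [measurable]: "\<phi> \<in> borel_measurable borel"
    unfolding \<phi>_def by (rule measurable_compose[OF _ T.quantile_measurable]) measurable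
  have \<phi>_distr: "distr (distr N borel f) borel \<phi> = T"
    unfolding \<phi>_def
    by (rule distr_quantile_cdf(1)) (use S0 T.positive_real_distribution_axioms in \<open>auto intro: S.real_distribution_axioms\<close>)
  let ?\<sigma> = "scale_measure (1 / V) \<sigma>"
  let ?\<Phi> = "\<lambda>z::real \<times> (real ^ 'n). scale_leaves t (fst z) (snd z)"
  have [measurable]: "?\<Phi> \<in> borel_measurable (borel \<Otimes>\<^sub>M borel)" by measurable
  have sf: "sigma_finite_measure ?\<sigma>"
    by (rule sigma_finite_direction_law[OF V0])
  have id: "distr ?\<sigma> borel (\<lambda>u. u) = ?\<sigma>"
    by (rule distr_id2) simp
  \<comment> \<open>Multiplying \<open>y\<close> by \<open>\<phi> r / r\<close> gives its direction
    the new length \<open>\<phi> r\<close>. With division by zero equal to zero, this is an identity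
    at every point.\<close>
  have "distr N borel (\<lambda>y. scale_leaves t (radial_factor (distr N borel f) T (f y)) y)
      = distr N borel (\<lambda>y. ?\<Phi> ((\<lambda>(r, u). (\<phi> r, u)) (f y, dir y)))"
    by (intro distr_cong) (auto simp: radial_factor_def \<phi>_def dir_def)
  also have "\<dots> = distr (distr (distr N (borel \<Otimes>\<^sub>M borel) (\<lambda>y. (f y, dir y)))
      (borel \<Otimes>\<^sub>M borel) (\<lambda>(r, u). (\<phi> r, u))) borel ?\<Phi>"
    by (simp add: distr_distr comp_def)
  also have "distr N (borel \<Otimes>\<^sub>M borel) (\<lambda>y. (f y, dir y)) = distr N borel f \<Otimes>\<^sub>M ?\<sigma>"
    by (rule polar_independence[symmetric, OF assms(1) V0 N prob])
  also have "distr (distr N borel f \<Otimes>\<^sub>M ?\<sigma>) (borel \<Otimes>\<^sub>M borel) (\<lambda>(r, u). (\<phi> r, u))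
      = distr (distr N borel f) borel \<phi> \<Otimes>\<^sub>M distr ?\<sigma> borel (\<lambda>u. u)"
    by (rule pair_measure_distr[symmetric]) (use sf in \<open>auto simp: id\<close>)
  also have "\<dots> = distr N' borel f \<Otimes>\<^sub>M ?\<sigma>"
    by (simp only: id \<phi>_distr T')
  also have "\<dots> = distr N' (borel \<Otimes>\<^sub>M borel) (\<lambda>y. (f y, dir y))"
    by (rule polar_independence[OF _ V0 N'_def prob']) simp
  also have "distr \<dots> borel ?\<Phi> = distr N' borel (\<lambda>y. ?\<Phi> (f y, dir y))"
    by (simp add: distr_distr comp_def)
  \<comment> \<open>Radius and direction give back \<open>y\<close> where \<open>f y > 0\<close>,
    hence only almost everywhere.\<close>
  also have "\<dots> = distr N' borel (\<lambda>y. y)"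
  proof (rule distr_cong_AE)
    show "AE y in N'. ?\<Phi> (f y, dir y) = y"
      using AE_radial_density_f_pos[of h] unfolding N'_def
      by (auto elim!: eventually_mono simp: dir_def)
  qed auto
  also have "\<dots> = N'" by (rule distr_id2) (simp add: N'_def)
  finally show ?thesis
    using c T' prob' by (intro exI[of _ c]) (simp add: N'_def h_def)
qed

end

section \<open>The recursion over the tree\<close>

text \<open>This is \<open>lp_tree_wf\<close> without the demand that the leaves exhaust all
  coordinates, so that children inherit it.\<close>

definition proper :: "'i lp_tree \<Rightarrow> bool" where
  "proper t \<longleftrightarrow> (\<forall>p ts. Inner p ts \<in> lp_subtrees t \<longrightarrow> p > 0 \<and> length ts \<ge> 2) \<and> distinct (leaves t)"

lemma proper_Inner:
  assumes "proper (Inner p ts)"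
  shows "p > 0" "ts \<noteq> []" "distinct (concat (map leaves ts))"
    "\<And>t. t \<in> set ts \<Longrightarrow> proper t"
proof -
  have *: "\<And>q us. Inner q us \<in> lp_subtrees (Inner p ts) \<Longrightarrow> q > 0 \<and> length us \<ge> 2"
    and d: "distinct (concat (map leaves ts))"
    using assms by (auto simp: proper_def)
  show "p > 0" "ts \<noteq> []" using *[of p ts] by auto
  show "distinct (concat (map leaves ts))" by fact
  show "proper t" if "t \<in> set ts" for t
    unfolding proper_def using that * d by (auto simp: distinct_concat_iff)
qed

lemma proper_leaves_nonempty: "proper t \<Longrightarrow> leaves t \<noteq> []"
proof (induction t)
  case (Inner p ts)
  note I = proper_Inner[OF Inner.prems]
  obtain t where "t \<in> set ts" using I(2) by (cases ts) auto
  then show ?case using Inner.IH I(4) by auto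
qed simp

section \<open>Homogeneity and locality of nested functions\<close>

lemma lp_nested_nonneg: "lp_nested t y \<ge> 0"
  by (cases t) auto

lemma borel_measurable_sum_list:
  fixes g :: "'b \<Rightarrow> 'c \<Rightarrow> real"
  shows "(\<And>x. x \<in> set xs \<Longrightarrow> g x \<in> borel_measurable M) \<Longrightarrow> (\<lambda>y. \<Sum>x\<leftarrow>xs. g x y) \<in> borel_measurable M"
  by (induction xs) auto

lemma borel_measurable_prod_list:
  fixes g :: "'b \<Rightarrow> 'c \<Rightarrow> real"
  shows "(\<And>x. x \<in> set xs \<Longrightarrow> g x \<in> borel_measurable M) \<Longrightarrow> (\<lambda>y. \<Prod>x\<leftarrow>xs. g x y) \<in> borel_measurable M"
  by (induction xs) auto

lemma borel_measurable_vec_nth [measurable]: "(\<lambda>y :: real ^ 'n::finite. y $ i) \<in> borel_measurable borel"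
  by (intro borel_measurable_continuous_onI continuous_intros)

lemma lp_nested_measurable [measurable]: "lp_nested t \<in> borel_measurable borel"
proof (induction t)
  case (Leaf i)
  have "lp_nested (Leaf i) = (\<lambda>y :: real ^ 'a. \<bar>y $ i\<bar>)" by auto
  then show ?case by simp
next
  case (Inner p ts)
  have "(\<lambda>y :: real ^ 'a. \<Sum>t\<leftarrow>ts. lp_nested t y powr p) \<in> borel_measurable borel"
    using Inner by (intro borel_measurable_sum_list) auto
  moreover have "lp_nested (Inner p ts) = (\<lambda>y :: real ^ 'a. (\<Sum>t\<leftarrow>ts. lp_nested t y powr p) powr (1 / p))" by auto
  ultimately show ?case by simp
qed

text \<open>The separate tree \<open>s\<close> fixes the stretched coordinates while the induction
  descends to the children of \<open>t\<close>.\<close>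

lemma lp_nested_scale:
  assumes "proper t" "set (leaves t) \<subseteq> set (leaves s)" "c > 0"
  shows "lp_nested t (scale_leaves s c y) = c * lp_nested t y"
  using assms
proof (induction t)
  case (Leaf i)
  then show ?case by (simp add: scale_leaves_def abs_mult)
next
  case (Inner p ts)
  note I = proper_Inner[OF Inner.prems(1)]
  have "lp_nested t (scale_leaves s c y) powr p = c powr p * lp_nested t y powr p" if "t \<in> set ts" for t
  proof -
    have "set (leaves t) \<subseteq> set (leaves s)" using that Inner.prems(2) by auto
    then have "lp_nested t (scale_leaves s c y) = c * lp_nested t y"
      by (rule Inner.IH[OF that I(4)[OF that] _ Inner.prems(3)])
    then show ?thesis using Inner.prems(3) by (simp add: powr_mult lp_nested_nonneg)
  qed
  then have "(\<Sum>t\<leftarrow>ts. lp_nested t (scale_leaves s c y) powr p) = c powr p * (\<Sum>t\<leftarrow>ts. lp_nested t y powr p)"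
    by (simp add: sum_list_const_mult[symmetric] cong: map_cong)
  then show ?case
    using I(1) Inner.prems(3) by (simp add: powr_mult powr_powr sum_list_nonneg)
qed

text \<open>Each summand is at most the whole sum. This puts the unit ball inside a cube and makes
  the nested function positive at the all-ones vector.\<close>

lemma abs_le_lp_nested:
  assumes "proper t" "i \<in> set (leaves t)"
  shows "\<bar>y $ i\<bar> \<le> lp_nested t y"
  using assms
proof (induction t)
  case (Inner p ts)
  note I = proper_Inner[OF Inner.prems(1)]
  obtain t where t: "t \<in> set ts" "i \<in> set (leaves t)" using Inner.prems by auto
  have "\<bar>y $ i\<bar> \<le> lp_nested t y" using Inner.IH[OF t(1) I(4)[OF t(1)] t(2)] .
  also have "\<dots> = (lp_nested t y powr p) powr (1 / p)"
    using I(1) by (simp add: powr_powr lp_nested_nonneg)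
  also have "\<dots> \<le> (\<Sum>t\<leftarrow>ts. lp_nested t y powr p) powr (1 / p)"
    using I(1) t(1) by (intro powr_mono2 member_le_sum_list) auto
  finally show ?case by simp
qed simp

text \<open>Independence of coordinates is expressed on the whole space, which avoids splitting it
  into a product over the leaves below a node and the others.\<close>

definition ignores :: "'n set \<Rightarrow> (real ^ 'n \<Rightarrow> 'b) \<Rightarrow> bool" where
  "ignores A k \<longleftrightarrow> (\<forall>y y'. (\<forall>i. i \<notin> A \<longrightarrow> y $ i = y' $ i) \<longrightarrow> k y = k y')"

lemma ignores_mono: "ignores A k \<Longrightarrow> B \<subseteq> A \<Longrightarrow> ignores B k"
  unfolding ignores_def by blast

lemma ignores_scale_leaves:
  fixes t :: "'n::finite lp_tree"
  shows "ignores (set (leaves t)) k \<Longrightarrow> k (scale_leaves t c y) = k y"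
  unfolding ignores_def by (simp add: scale_leaves_def)

lemma ignores_comp2: "ignores A g \<Longrightarrow> ignores A h \<Longrightarrow> ignores A (\<lambda>y. F (g y) (h y))"
  unfolding ignores_def by metis

lemma ignores_prod_list:
  fixes g :: "'b \<Rightarrow> real ^ 'n \<Rightarrow> real"
  shows "(\<And>x. x \<in> set xs \<Longrightarrow> ignores A (g x)) \<Longrightarrow> ignores A (\<lambda>y. \<Prod>x\<leftarrow>xs. g x y)"
  by (induction xs) (auto intro: ignores_comp2 simp: ignores_def[of _ "\<lambda>y. 1"])

lemma lp_nested_cong:
  "(\<And>i. i \<in> set (leaves t) \<Longrightarrow> y $ i = y' $ i) \<Longrightarrow> lp_nested t y = lp_nested t y'"
proof (induction t)
  case (Inner p ts)
  have "lp_nested t y = lp_nested t y'" if "t \<in> set ts" for t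
    by (rule Inner.IH[OF that]) (use that Inner.prems in auto)
  then have "map (\<lambda>t. lp_nested t y powr p) ts = map (\<lambda>t. lp_nested t y' powr p) ts"
    by (intro map_cong) auto
  then show ?case by (simp only: lp_nested.simps)
qed simp

lemma ignores_lp_nested: "A \<inter> set (leaves t) = {} \<Longrightarrow> ignores A (lp_nested t)"
  unfolding ignores_def by (auto intro!: lp_nested_cong)

lemma radial_scaling_lp_nested:
  assumes proper: "proper t" and "k \<in> borel_measurable borel" and ign: "ignores (set (leaves t)) k"
    and "(\<integral>\<^sup>+y. k y * indicator {y. lp_nested t y \<le> 1} y \<partial>lborel) < \<infinity>"
  shows "radial_scaling t (lp_nested t) k"
proof
  show "distinct (leaves t)" using proper by (simp add: proper_def)
  show "leaves t \<noteq> []" by (rule proper_leaves_nonempty[OF proper])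
  show "lp_nested t (scale_leaves t c y) = c * lp_nested t y" if "c > 0" for c y
    by (rule lp_nested_scale[OF proper _ that]) simp
  show "k (scale_leaves t c y) = k y" for c y
    by (rule ignores_scale_leaves[OF ign])
qed (use assms in \<open>auto simp: lp_nested_nonneg\<close>)

text \<open>Here \<open>q\<close> is the exponent of the parent: this is the factor that the child
  \<open>t\<close> contributes to the target density of its parent.\<close>

definition radial_gauss :: "'n::finite lp_tree \<Rightarrow> real \<Rightarrow> real ^ 'n \<Rightarrow> real" where
  "radial_gauss t q y = exp (- (lp_nested t y powr q) / exponent_scale q)"

text \<open>A leaf needs the exponent of its parent, hence the argument \<open>q\<close>; an inner
  node hands its own exponent to its children.\<close>

fun leaf_gauss :: "'n::finite lp_tree \<Rightarrow> real \<Rightarrow> real ^ 'n \<Rightarrow> real" where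
  "leaf_gauss (Leaf i) q y = exp (- (\<bar>y $ i\<bar> powr q) / exponent_scale q)"
| "leaf_gauss (Inner p ts) q y = (\<Prod>t\<leftarrow>ts. leaf_gauss t p y)"

lemma radial_gauss_measurable [measurable]: "radial_gauss t q \<in> borel_measurable borel"
  unfolding radial_gauss_def by measurable

lemma radial_gauss_nonneg: "radial_gauss t q y \<ge> 0"
  by (simp add: radial_gauss_def)

lemma prod_list_nonneg_real: "(\<And>x. x \<in> set xs \<Longrightarrow> x \<ge> (0::real)) \<Longrightarrow> prod_list xs \<ge> 0"
  by (induction xs) auto

lemma leaf_gauss_nonneg: "leaf_gauss t q y \<ge> 0"
  by (induction t q y rule: leaf_gauss.induct) (auto intro!: prod_list_nonneg_real)

lemma leaf_gauss_measurable [measurable]: "leaf_gauss t q \<in> borel_measurable borel"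
proof (induction t arbitrary: q)
  case (Leaf i)
  have "leaf_gauss (Leaf i) q = (\<lambda>y :: real ^ 'a. exp (- (\<bar>y $ i\<bar> powr q) / exponent_scale q))" by auto
  then show ?case by simp
next
  case (Inner p ts)
  have "leaf_gauss (Inner p ts) q = (\<lambda>y :: real ^ 'a. \<Prod>t\<leftarrow>ts. leaf_gauss t p y)" by auto
  then show ?case using Inner by (auto intro!: borel_measurable_prod_list)
qed

lemma ignores_leaf_gauss: "A \<inter> set (leaves t) = {} \<Longrightarrow> ignores A (leaf_gauss t q)"
proof (induction t arbitrary: q)
  case (Leaf i)
  then show ?case by (auto simp: ignores_def)
next
  case (Inner p ts)
  have "leaf_gauss (Inner p ts) q = (\<lambda>y :: real ^ 'a. \<Prod>t\<leftarrow>ts. leaf_gauss t p y)" by auto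
  then show ?case using Inner by (fastforce intro!: ignores_prod_list)
qed

lemma ignores_radial_gauss: "A \<inter> set (leaves t) = {} \<Longrightarrow> ignores A (radial_gauss t q)"
  using ignores_lp_nested[of A t] unfolding ignores_def radial_gauss_def by metis

text \<open>The p-th power of the value at the node is the sum of those of the children, and
  \<open>exp\<close> turns the sum into a product. This works because the target profile has the
  node's own exponent.\<close>

lemma radial_gauss_Inner:
  assumes "p > 0"
  shows "exp (- (lp_nested (Inner p ts) y powr p) / exponent_scale p) = (\<Prod>t\<leftarrow>ts. radial_gauss t p y)"
proof -
  have "(\<Sum>t\<leftarrow>ts. lp_nested t y powr p) \<ge> 0"
    by (intro sum_list_nonneg) auto
  then have "lp_nested (Inner p ts) y powr p = (\<Sum>t\<leftarrow>ts. lp_nested t y powr p)"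
    using assms by (simp add: powr_powr)
  moreover have "exp (- (\<Sum>t\<leftarrow>ts. lp_nested t y powr p) / exponent_scale p) = (\<Prod>t\<leftarrow>ts. radial_gauss t p y)"
  proof (induction ts)
    case (Cons t ts)
    have "exp (- (\<Sum>t\<leftarrow>t # ts. lp_nested t y powr p) / exponent_scale p)
        = radial_gauss t p y * exp (- (\<Sum>t\<leftarrow>ts. lp_nested t y powr p) / exponent_scale p)"
      by (simp add: radial_gauss_def add_divide_distrib diff_divide_distrib flip: exp_add)
    then show ?case using Cons by simp
  qed simp
  ultimately show ?thesis by simp
qed

section \<open>Induction along the recursion\<close>

lemma radial_factor_measurable:
  assumes S: "real_distribution S" and T: "positive_real_distribution T"
  shows "radial_factor S T \<in> borel_measurable borel"
proof -
  interpret S: real_distribution S by fact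
  interpret T: positive_real_distribution T by fact
  have [measurable]: "cdf S \<in> borel_measurable borel"
    by (intro borel_measurable_mono monoI S.cdf_nondecreasing)
  have [measurable]: "(\<lambda>r. the_inv_into {0<..} (cdf T) (cdf S r)) \<in> borel_measurable borel"
    by (rule measurable_compose[OF _ T.quantile_measurable]) measurable
  show ?thesis unfolding radial_factor_def[abs_def] by measurable
qed

text \<open>One formula in two roles: the target law of a node \<open>t\<close> with exponent
  \<open>p\<close>, and the source law of a child \<open>t\<close> of a node with exponent
  \<open>p\<close>.\<close>

abbreviation node_gamma :: "real \<Rightarrow> 'n lp_tree \<Rightarrow> real measure" where
  "node_gamma p t \<equiv> gamma_dist p (real (length (leaves t)) / p) (exponent_scale p)"

lemma positive_node_gamma:
  assumes "proper t" "p > 0"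
  shows "positive_real_distribution (node_gamma p t)"
  using assms proper_leaves_nonempty[of t]
  by (intro positive_real_distribution_gamma_dist exponent_scale_pos) auto

lemma measurable_fold:
  "(\<And>x. x \<in> set xs \<Longrightarrow> g x \<in> measurable M M) \<Longrightarrow> fold g xs \<in> measurable M M"
proof (induction xs)
  case (Cons x xs)
  have "fold g xs \<circ> g x \<in> measurable M M"
    by (rule measurable_comp) (use Cons in auto)
  then show ?case by (simp only: fold.simps)
qed (simp add: id_def)

lemma nrf_rec_measurable:
  "proper t \<Longrightarrow> real_distribution S \<Longrightarrow> nrf_rec t S \<in> borel_measurable borel"
proof (induction t arbitrary: S)
  case (Leaf i)
  have "nrf_rec (Leaf i) S = (\<lambda>y :: real ^ 'a. y)" by auto
  then show ?case by simp
next
  case (Inner p ts)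
  note I = proper_Inner[OF Inner.prems(1)]
  let ?I = "Inner p ts"
  have T: "positive_real_distribution (node_gamma p ?I)"
    by (rule positive_node_gamma[OF Inner.prems(1) I(1)])
  have [measurable]: "radial_factor S (node_gamma p ?I) \<in> borel_measurable borel"
    by (rule radial_factor_measurable[OF Inner.prems(2) T])
  have [measurable]: "nrf_rec t (node_gamma p t) \<in> borel_measurable borel" if "t \<in> set ts" for t
    using that I(1) I(4)[OF that] positive_node_gamma[of t p]
    by (intro Inner.IH) (auto simp: positive_real_distribution_def)
  have [measurable]: "fold (\<lambda>t. nrf_rec t (node_gamma p t)) ts \<in> borel_measurable borel"
    by (rule measurable_fold) measurable
  have "nrf_rec ?I S = (\<lambda>y. fold (\<lambda>t. nrf_rec t (node_gamma p t)) ts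
      (scale_leaves ?I (radial_factor S (node_gamma p ?I) (lp_nested ?I y)) y))"
    by (auto simp: Let_def simp del: leaves.simps lp_nested.simps)
  then show ?case by (simp only:) measurable
qed

text \<open>The induction hypothesis over the tree. The weight \<open>k\<close> is arbitrary in
  order to receive the factors of the siblings; \<open>c'\<close> may stay unspecified, since total
  mass one determines it.\<close>

definition factorizes :: "'n::finite lp_tree \<Rightarrow> real \<Rightarrow> bool" where
  "factorizes t q \<longleftrightarrow> (\<forall>k c. k \<in> borel_measurable borel \<longrightarrow> ignores (set (leaves t)) k \<longrightarrow> c > 0 \<longrightarrow>
     prob_space (density lborel (\<lambda>y. ennreal (c * radial_gauss t q y) * k y)) \<longrightarrow>
     (\<exists>c'>0. distr (density lborel (\<lambda>y. ennreal (c * radial_gauss t q y) * k y)) borel (nrf_rec t (node_gamma q t))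
        = density lborel (\<lambda>y. ennreal (c' * leaf_gauss t q y) * k y)))"

text \<open>When a child is processed, its later siblings still contribute
  \<open>radial_gauss\<close> and its earlier ones already \<open>leaf_gauss\<close>. Distinctness
  of the leaves makes all these factors independent of the child's coordinates, so they count as
  weight.\<close>

lemma fold_factorizes:
  fixes ts :: "'n::finite lp_tree list"
  assumes p: "p > 0"
  shows "\<lbrakk>\<And>t. t \<in> set ts \<Longrightarrow> proper t; \<And>t. t \<in> set ts \<Longrightarrow> factorizes t p;
      distinct (concat (map leaves ts)); k \<in> borel_measurable borel;
      ignores (set (concat (map leaves ts))) k; c > 0;
      prob_space (density lborel (\<lambda>y. ennreal (c * (\<Prod>t\<leftarrow>ts. radial_gauss t p y)) * k y))\<rbrakk> \<Longrightarrow>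
    \<exists>c'>0. distr (density lborel (\<lambda>y. ennreal (c * (\<Prod>t\<leftarrow>ts. radial_gauss t p y)) * k y)) borel
        (fold (\<lambda>t. nrf_rec t (node_gamma p t)) ts)
      = density lborel (\<lambda>y. ennreal (c' * (\<Prod>t\<leftarrow>ts. leaf_gauss t p y)) * k y)"
proof (induction ts arbitrary: k c)
  case Nil
  then show ?case
    by (intro exI[of _ c]) (auto simp: id_def intro!: distr_id2)
next
  case (Cons t ts)
  note [measurable] = Cons.prems(4)
  define R where "R y = (\<Prod>t\<leftarrow>ts. radial_gauss t p y)" for y
  have [measurable]: "R \<in> borel_measurable borel"
    unfolding R_def by (rule borel_measurable_prod_list) measurable
  have R0: "R y \<ge> 0" for y
    unfolding R_def by (rule prod_list_nonneg_real) (auto simp: radial_gauss_nonneg)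
  define N where "N = density lborel (\<lambda>y. ennreal (c * (\<Prod>t\<leftarrow>t # ts. radial_gauss t p y)) * k y)"
  \<comment> \<open>The weight for the first child: \<open>k\<close> times the profiles of the
    children still to come.\<close>
  define k1 where "k1 y = ennreal (R y) * k y" for y
  have k1 [measurable]: "k1 \<in> borel_measurable borel" unfolding k1_def by measurable
  have N: "N = density lborel (\<lambda>y. ennreal (c * radial_gauss t p y) * k1 y)"
    unfolding N_def k1_def using Cons.prems(6) R0
    by (simp add: R_def[symmetric] ennreal_mult' radial_gauss_nonneg mult.assoc)
  have disj: "set (leaves t) \<inter> (\<Union>x\<in>set ts. set (leaves x)) = {}"
    using Cons.prems(3) by auto
  have "ignores (set (leaves t)) R"
    unfolding R_def using disj by (intro ignores_prod_list ignores_radial_gauss) auto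
  then have "ignores (set (leaves t)) k1"
    unfolding k1_def using ignores_mono[OF Cons.prems(5), of "set (leaves t)"]
    by (intro ignores_comp2[where F = "\<lambda>a b. ennreal a * b"]) auto
  note ign1 = this
  have probN: "prob_space N" unfolding N_def by (rule Cons.prems(7))
  have "factorizes t p" by (rule Cons.prems(2)) simp
  from this[unfolded factorizes_def, rule_format, OF k1 ign1 Cons.prems(6) probN[unfolded N]]
  obtain c1 where c1: "c1 > 0"
    "distr N borel (nrf_rec t (node_gamma p t)) = density lborel (\<lambda>y. ennreal (c1 * leaf_gauss t p y) * k1 y)"
    unfolding N by blast
  \<comment> \<open>The weight for the remaining children: \<open>k\<close> times the finished
    factor of the first child.\<close>
  define k2 where "k2 y = ennreal (leaf_gauss t p y) * k y" for y
  have k2 [measurable]: "k2 \<in> borel_measurable borel" unfolding k2_def by measurable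
  have N1: "distr N borel (nrf_rec t (node_gamma p t)) = density lborel (\<lambda>y. ennreal (c1 * R y) * k2 y)"
    unfolding c1(2) k1_def k2_def using c1(1) R0
    by (simp add: ennreal_mult' leaf_gauss_nonneg ac_simps)
  have "ignores (set (concat (map leaves ts))) (leaf_gauss t p)"
    using disj by (intro ignores_leaf_gauss) auto
  then have ig: "ignores (set (concat (map leaves ts))) k2"
    unfolding k2_def using ignores_mono[OF Cons.prems(5), of "set (concat (map leaves ts))"]
    by (intro ignores_comp2[where F = "\<lambda>a b. ennreal a * b"]) auto
  have meas: "nrf_rec x (node_gamma p x) \<in> borel_measurable borel" if "x \<in> set (t # ts)" for x
    using that p Cons.prems(1)[OF that] positive_node_gamma[of x p]
    by (intro nrf_rec_measurable) (auto simp: positive_real_distribution_def)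
  have [measurable]: "nrf_rec t (node_gamma p t) \<in> borel_measurable borel" by (rule meas) simp
  have [measurable]: "fold (\<lambda>t. nrf_rec t (node_gamma p t)) ts \<in> borel_measurable borel"
    by (rule measurable_fold) (use meas in auto)
  have "prob_space (distr N borel (nrf_rec t (node_gamma p t)))"
    by (rule prob_space.prob_space_distr[OF probN]) (simp add: N)
  then have prob1: "prob_space (density lborel (\<lambda>y. ennreal (c1 * R y) * k2 y))"
    by (simp only: N1)
  have "\<exists>c'>0. distr (density lborel (\<lambda>y. ennreal (c1 * R y) * k2 y)) borel
        (fold (\<lambda>t. nrf_rec t (node_gamma p t)) ts)
      = density lborel (\<lambda>y. ennreal (c' * (\<Prod>t\<leftarrow>ts. leaf_gauss t p y)) * k2 y)"
    unfolding R_def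
    by (rule Cons.IH) (use Cons.prems ig k2 c1(1) prob1 in \<open>auto simp: R_def\<close>)
  then obtain c2 where c2: "c2 > 0" "distr (density lborel (\<lambda>y. ennreal (c1 * R y) * k2 y)) borel
        (fold (\<lambda>t. nrf_rec t (node_gamma p t)) ts)
      = density lborel (\<lambda>y. ennreal (c2 * (\<Prod>t\<leftarrow>ts. leaf_gauss t p y)) * k2 y)" by blast
  have "distr N borel (fold (\<lambda>t. nrf_rec t (node_gamma p t)) (t # ts))
      = distr (distr N borel (nrf_rec t (node_gamma p t))) borel (fold (\<lambda>t. nrf_rec t (node_gamma p t)) ts)"
    by (subst distr_distr) (auto simp: N comp_def)
  also have "\<dots> = density lborel (\<lambda>y. ennreal (c2 * (\<Prod>t\<leftarrow>ts. leaf_gauss t p y)) * k2 y)"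
    unfolding N1 by (rule c2(2))
  also have "\<dots> = density lborel (\<lambda>y. ennreal (c2 * (\<Prod>t\<leftarrow>t # ts. leaf_gauss t p y)) * k y)"
  proof -
    have "(\<Prod>t\<leftarrow>ts. leaf_gauss t p y) \<ge> 0" for y
      by (rule prod_list_nonneg_real) (auto simp: leaf_gauss_nonneg)
    then show ?thesis
      unfolding k2_def using c2(1) by (simp add: ennreal_mult' leaf_gauss_nonneg ac_simps)
  qed
  finally show ?case using c2(1) unfolding N_def by blast
qed

text \<open>The profile \<open>G\<close> is left open to cover both the root with its arbitrary
  radial law and inner nodes further down, where \<open>G\<close> comes from the exponent of the
  parent.\<close>

lemma nrf_rec_Inner:
  fixes ts :: "'n::finite lp_tree list"
  assumes proper: "proper (Inner p ts)" and IH: "\<And>t. t \<in> set ts \<Longrightarrow> factorizes t p"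
    and [measurable]: "G \<in> borel_measurable borel" "k \<in> borel_measurable borel"
    and ign: "ignores (set (leaves (Inner p ts))) k"
    and fin: "(\<integral>\<^sup>+y. k y * indicator {y. lp_nested (Inner p ts) y \<le> 1} y \<partial>lborel) < \<infinity>"
    and N: "N = density lborel (\<lambda>y. G (lp_nested (Inner p ts) y) * k y)" "prob_space N"
  shows "\<exists>c'>0. distr N borel (nrf_rec (Inner p ts) (distr N borel (lp_nested (Inner p ts))))
      = density lborel (\<lambda>y. ennreal (c' * leaf_gauss (Inner p ts) q y) * k y)"
proof -
  note I = proper_Inner[OF proper]
  let ?I = "Inner p ts"
  let ?S = "distr N borel (lp_nested ?I)"
  interpret radial_scaling ?I "lp_nested ?I" k
    by (rule radial_scaling_lp_nested[OF proper assms(4) ign fin])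
  obtain c where c: "c > 0"
    and prob: "prob_space (density lborel (\<lambda>y. ennreal (c * exp (- (lp_nested ?I y powr p) / exponent_scale p)) * k y))"
    and eq: "distr N borel (\<lambda>y. scale_leaves ?I (radial_factor ?S (node_gamma p ?I) (lp_nested ?I y)) y)
        = density lborel (\<lambda>y. ennreal (c * exp (- (lp_nested ?I y powr p) / exponent_scale p)) * k y)"
    using radial_transform[OF _ N I(1) exponent_scale_pos[OF I(1)]] unfolding m_def by auto
  have "\<exists>c'>0. distr (density lborel (\<lambda>y. ennreal (c * (\<Prod>t\<leftarrow>ts. radial_gauss t p y)) * k y)) borel
        (fold (\<lambda>t. nrf_rec t (node_gamma p t)) ts)
      = density lborel (\<lambda>y. ennreal (c' * (\<Prod>t\<leftarrow>ts. leaf_gauss t p y)) * k y)"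
    by (rule fold_factorizes[OF I(1) I(4) IH I(3) _ _ c])
       (use prob ign in \<open>simp_all only: radial_gauss_Inner[OF I(1)] leaves.simps k_measurable\<close>)
  then obtain c' where c': "c' > 0" and eq': "distr (density lborel (\<lambda>y. ennreal (c * (\<Prod>t\<leftarrow>ts. radial_gauss t p y)) * k y)) borel
        (fold (\<lambda>t. nrf_rec t (node_gamma p t)) ts)
      = density lborel (\<lambda>y. ennreal (c' * (\<Prod>t\<leftarrow>ts. leaf_gauss t p y)) * k y)" by blast
  have real_S: "real_distribution ?S"
    by (rule prob_space.real_distribution_distr[OF N(2)]) (simp add: N(1) del: lp_nested.simps)
  have [measurable]: "radial_factor ?S (node_gamma p ?I) \<in> borel_measurable borel"
    by (rule radial_factor_measurable[OF real_S positive_node_gamma[OF proper I(1)]])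
  have meas: "nrf_rec x (node_gamma p x) \<in> borel_measurable borel" if "x \<in> set ts" for x
    using that I(1) I(4)[OF that] positive_node_gamma[of x p]
    by (intro nrf_rec_measurable) (auto simp: positive_real_distribution_def)
  have [measurable]: "fold (\<lambda>t. nrf_rec t (node_gamma p t)) ts \<in> borel_measurable borel"
    by (rule measurable_fold) (rule meas)
  have [measurable_cong]: "sets N = sets borel" by (simp add: N(1))
  have "nrf_rec ?I ?S = (\<lambda>y. fold (\<lambda>t. nrf_rec t (node_gamma p t)) ts
      (scale_leaves ?I (radial_factor ?S (node_gamma p ?I) (lp_nested ?I y)) y))"
    by (auto simp: Let_def simp del: leaves.simps lp_nested.simps)
  then have "distr N borel (nrf_rec ?I ?S)
      = distr (distr N borel (\<lambda>y. scale_leaves ?I (radial_factor ?S (node_gamma p ?I) (lp_nested ?I y)) y)) borel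
          (fold (\<lambda>t. nrf_rec t (node_gamma p t)) ts)"
    by (simp add: distr_distr comp_def del: leaves.simps lp_nested.simps nrf_rec.simps)
  also have "\<dots> = density lborel (\<lambda>y. ennreal (c' * (\<Prod>t\<leftarrow>ts. leaf_gauss t p y)) * k y)"
    unfolding eq radial_gauss_Inner[OF I(1)] by (rule eq')
  finally show ?thesis using c' by auto
qed

text \<open>At an inner node two things have to be supplied to \<open>nrf_rec_Inner\<close>: finite
  weight of the unit ball, and the fact that the radial law is the \<open>node_gamma q\<close> of
  the recursion.\<close>

lemma factorizes:
  fixes t :: "'n::finite lp_tree"
  shows "proper t \<Longrightarrow> q > 0 \<Longrightarrow> factorizes t q"
proof (induction t arbitrary: q)
  case (Leaf i)
  show ?case
    unfolding factorizes_def
  proof (intro allI impI)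
    fix k :: "real ^ 'n \<Rightarrow> ennreal" and c :: real
    assume "c > 0"
    have "nrf_rec (Leaf i) S = (\<lambda>y. y)" for S :: "real measure" by auto
    then show "\<exists>c'>0. distr (density lborel (\<lambda>y. ennreal (c * radial_gauss (Leaf i) q y) * k y)) borel
        (nrf_rec (Leaf i) (node_gamma q (Leaf i))) = density lborel (\<lambda>y. ennreal (c' * leaf_gauss (Leaf i) q y) * k y)"
      using \<open>c > 0\<close> by (intro exI[of _ c]) (simp add: radial_gauss_def distr_id2)
  qed
next
  case (Inner p ts)
  note I = proper_Inner[OF Inner.prems(1)]
  let ?I = "Inner p ts"
  show ?case
    unfolding factorizes_def
  proof (intro allI impI)
    fix k :: "real ^ 'n \<Rightarrow> ennreal" and c :: real
    assume k [measurable]: "k \<in> borel_measurable borel" and ign: "ignores (set (leaves ?I)) k" and c: "c > 0"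
    define N where "N = density lborel (\<lambda>y. ennreal (c * radial_gauss ?I q y) * k y)"
    assume "prob_space (density lborel (\<lambda>y. ennreal (c * radial_gauss ?I q y) * k y))"
    then have probN: "prob_space N" by (simp add: N_def)
    define G where "G r = ennreal (c * exp (- (r powr q) / exponent_scale q))" for r
    have [measurable]: "G \<in> borel_measurable borel" unfolding G_def by measurable
    have N: "N = density lborel (\<lambda>y. G (lp_nested ?I y) * k y)"
      by (simp add: N_def G_def radial_gauss_def)
    \<comment> \<open>On the unit ball the profile \<open>G\<close> is at least
      \<open>c * exp (- 1 / exponent_scale q)\<close>, so \<open>k\<close> is there at most
      \<open>b\<close> times a density of total mass one.\<close>
    define b where "b = exp (1 / exponent_scale q) / c"
    have s: "exponent_scale q > 0" by (rule exponent_scale_pos[OF Inner.prems(2)])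
    have bd: "k y * indicator {y. lp_nested ?I y \<le> 1} y \<le> ennreal b * (G (lp_nested ?I y) * k y)" for y
    proof (cases "lp_nested ?I y \<le> 1")
      case True
      then have "lp_nested ?I y powr q \<le> 1 powr q"
        using Inner.prems(2) by (intro powr_mono2) (auto simp: lp_nested_nonneg simp del: lp_nested.simps)
      then have "1 \<le> exp (1 / exponent_scale q + - (lp_nested ?I y powr q) / exponent_scale q)"
        using s by (simp add: field_simps del: lp_nested.simps)
      also have "\<dots> = b * (c * exp (- (lp_nested ?I y powr q) / exponent_scale q))"
        unfolding exp_add b_def using c by simp
      finally have "ennreal 1 \<le> ennreal b * G (lp_nested ?I y)"
        unfolding G_def using c by (subst ennreal_mult'[symmetric]) (auto intro!: ennreal_leI simp: b_def simp del: lp_nested.simps)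
      from mult_right_mono[OF this, of "k y"] show ?thesis
        using True by (simp add: mult.assoc del: lp_nested.simps)
    qed (simp del: lp_nested.simps)
    have "(\<integral>\<^sup>+y. k y * indicator {y. lp_nested ?I y \<le> 1} y \<partial>lborel)
        \<le> (\<integral>\<^sup>+y. ennreal b * (G (lp_nested ?I y) * k y) \<partial>lborel)"
      by (intro nn_integral_mono bd)
    also have "\<dots> = ennreal b * emeasure N (space N)"
      unfolding N by (subst nn_integral_cmult) (auto simp: emeasure_density simp del: lp_nested.simps)
    also have "\<dots> < \<infinity>"
      by (simp add: prob_space.emeasure_space_1[OF probN])
    finally have fin: "(\<integral>\<^sup>+y. k y * indicator {y. lp_nested ?I y \<le> 1} y \<partial>lborel) < \<infinity>" .
    interpret radial_scaling ?I "lp_nested ?I" k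
      by (rule radial_scaling_lp_nested[OF Inner.prems(1) k ign fin])
    \<comment> \<open>Applied with the parent's exponent \<open>q\<close>, the transform has the
      given profile as its target, up to the constant. It thereby tells the radial law of that
      profile.\<close>
    obtain c0 where c0: "c0 > 0"
      and prob0: "prob_space (density lborel (\<lambda>y. ennreal (c0 * exp (- (lp_nested ?I y powr q) / exponent_scale q)) * k y))"
      and distr0: "distr (density lborel (\<lambda>y. ennreal (c0 * exp (- (lp_nested ?I y powr q) / exponent_scale q)) * k y))
         borel (lp_nested ?I) = node_gamma q ?I"
      using radial_transform[OF _ N probN Inner.prems(2) s] unfolding m_def by auto
    \<comment> \<open>Both \<open>c\<close> and \<open>c0\<close> normalise this one integral, so
      they coincide.\<close>
    define J where "J = (\<integral>\<^sup>+y. ennreal (exp (- (lp_nested ?I y powr q) / exponent_scale q)) * k y \<partial>lborel)"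
    have J: "ennreal a * J = 1"
      if "prob_space (density lborel (\<lambda>y. ennreal (a * exp (- (lp_nested ?I y powr q) / exponent_scale q)) * k y))" "a > 0" for a
      using prob_space.emeasure_space_1[OF that(1)] that(2) unfolding J_def
      by (simp add: emeasure_density ennreal_mult' mult.assoc nn_integral_cmult del: lp_nested.simps)
    have "ennreal c * J = 1" "ennreal c0 * J = 1"
      using J[OF _ c] J[OF prob0 c0] probN by (simp_all add: N G_def del: lp_nested.simps)
    have "ennreal c = ennreal c * (ennreal c0 * J)"
      unfolding \<open>ennreal c0 * J = 1\<close> by simp
    also have "\<dots> = ennreal c0 * (ennreal c * J)"
      by (rule mult.left_commute)
    also have "\<dots> = ennreal c0"
      unfolding \<open>ennreal c * J = 1\<close> by simp
    finally have "c = c0" using c c0 by simp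
    with distr0 have S: "distr N borel (lp_nested ?I) = node_gamma q ?I"
      by (simp add: N G_def del: lp_nested.simps leaves.simps)
    have "\<exists>c'>0. distr N borel (nrf_rec ?I (distr N borel (lp_nested ?I)))
      = density lborel (\<lambda>y. ennreal (c' * leaf_gauss ?I q y) * k y)"
      using Inner.IH I(1,4) by (intro nrf_rec_Inner[OF Inner.prems(1) _ _ k ign fin N probN]) auto
    then show "\<exists>c'>0. distr (density lborel (\<lambda>y. ennreal (c * radial_gauss ?I q y) * k y)) borel
        (nrf_rec ?I (node_gamma q ?I)) = density lborel (\<lambda>y. ennreal (c' * leaf_gauss ?I q y) * k y)"
      unfolding N_def[symmetric] S .
  qed
qed

section \<open>Product densities\<close>

lemma measurable_vec_lambda:
  "(\<lambda>x. \<chi> i. x i) \<in> measurable (Pi\<^sub>M UNIV (\<lambda>_::'n::finite. lborel)) (borel :: (real ^ 'n) measure)"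
proof (subst borel_measurable_euclidean_space, safe)
  fix b :: "real ^ 'n" assume "b \<in> Basis"
  then obtain i where b: "b = axis i 1" by (auto simp: Basis_vec_def)
  have "(\<lambda>x. x i) \<in> measurable (Pi\<^sub>M UNIV (\<lambda>_::'n. lborel :: real measure)) lborel"
    by (rule measurable_component_singleton) simp
  then show "(\<lambda>x. (\<chi> i. x i) \<bullet> b) \<in> borel_measurable (Pi\<^sub>M UNIV (\<lambda>_::'n. lborel))"
    by (simp add: b inner_axis)
qed

text \<open>Lebesgue measure is determined by its values on boxes, and a box pulls back to a product
  of intervals.\<close>

lemma lborel_vec_eq_distr_PiM:
  "(lborel :: (real ^ 'n::finite) measure) = distr (Pi\<^sub>M UNIV (\<lambda>_. lborel)) borel (\<lambda>x. \<chi> i. x i)"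
proof (rule lborel_eqI)
  interpret product_sigma_finite "\<lambda>_::'n. lborel :: real measure"
    by (simp add: product_sigma_finite_def sigma_finite_lborel)
  fix l u :: "real ^ 'n" assume le: "\<And>b. b \<in> Basis \<Longrightarrow> l \<bullet> b \<le> u \<bullet> b"
  have le': "l $ i \<le> u $ i" for i
    using le[of "axis i 1"] by (simp add: inner_axis)
  have inj: "inj (\<lambda>i::'n. axis i (1::real))" by (auto simp: inj_on_def axis_eq_axis)
  have Basis: "(Basis :: (real ^ 'n) set) = range (\<lambda>i. axis i 1)"
    by (auto simp: Basis_vec_def)
  have "(\<lambda>x. \<chi> i. x i) -` box l u \<inter> space (Pi\<^sub>M UNIV (\<lambda>_::'n. lborel)) = (\<Pi>\<^sub>E i\<in>UNIV. {l $ i<..<u $ i})"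
    by (auto simp: mem_box_cart space_PiM PiE_iff)
  then have "emeasure (distr (Pi\<^sub>M UNIV (\<lambda>_. lborel)) borel (\<lambda>x. \<chi> i. x i)) (box l u)
      = emeasure (Pi\<^sub>M UNIV (\<lambda>_::'n. lborel)) (\<Pi>\<^sub>E i\<in>UNIV. {l $ i<..<u $ i})"
    by (subst emeasure_distr) (auto simp: measurable_vec_lambda)
  also have "\<dots> = (\<Prod>i\<in>UNIV. emeasure lborel {l $ i<..<u $ i})"
    by (rule emeasure_PiM) auto
  also have "\<dots> = ennreal (\<Prod>i\<in>UNIV. u $ i - l $ i)"
    using le' by (simp add: prod_ennreal)
  also have "(\<Prod>i\<in>UNIV. u $ i - l $ i) = (\<Prod>b\<in>Basis. (u - l) \<bullet> b)"
    unfolding Basis by (subst prod.reindex[OF inj]) (simp add: inner_axis)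
  finally show "emeasure (distr (Pi\<^sub>M UNIV (\<lambda>_. lborel)) borel (\<lambda>x. \<chi> i. x i)) (box l u)
      = (\<Prod>b\<in>Basis. (u - l) \<bullet> b)" .
qed simp

lemma nn_integral_vec_prod:
  fixes h :: "'n::finite \<Rightarrow> real \<Rightarrow> ennreal"
  assumes [measurable]: "\<And>i. h i \<in> borel_measurable borel"
  shows "(\<integral>\<^sup>+y. (\<Prod>i\<in>UNIV. h i (y $ i)) \<partial>(lborel :: (real ^ 'n) measure)) = (\<Prod>i\<in>UNIV. \<integral>\<^sup>+x. h i x \<partial>lborel)"
proof -
  interpret product_sigma_finite "\<lambda>_::'n. lborel :: real measure"
    by (simp add: product_sigma_finite_def sigma_finite_lborel)
  show ?thesis
    by (subst lborel_vec_eq_distr_PiM)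
       (simp add: nn_integral_distr measurable_vec_lambda product_nn_integral_prod)
qed

lemma density_PiM:
  fixes h :: "'n::finite \<Rightarrow> real \<Rightarrow> ennreal"
  assumes h [measurable]: "\<And>i. h i \<in> borel_measurable borel"
    and prob: "\<And>i. prob_space (density lborel (h i))"
  shows "density (Pi\<^sub>M UNIV (\<lambda>_. lborel)) (\<lambda>x. \<Prod>i\<in>UNIV. h i (x i)) = Pi\<^sub>M UNIV (\<lambda>i. density lborel (h i))"
proof -
  interpret L: product_sigma_finite "\<lambda>_::'n. lborel :: real measure"
    by (simp add: product_sigma_finite_def sigma_finite_lborel)
  interpret H: product_sigma_finite "\<lambda>i. density lborel (h i)"
    by (simp add: product_sigma_finite_def prob_space_imp_sigma_finite prob)
  show ?thesis
  proof (rule H.PiM_eqI)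
    show "sets (density (Pi\<^sub>M UNIV (\<lambda>_. lborel)) (\<lambda>x. \<Prod>i\<in>UNIV. h i (x i))) = sets (Pi\<^sub>M UNIV (\<lambda>i. density lborel (h i)))"
      by (auto intro!: sets_PiM_cong)
    fix A assume "\<And>i. i \<in> (UNIV :: 'n set) \<Longrightarrow> A i \<in> sets (density lborel (h i))"
    then have A [measurable]: "A i \<in> sets borel" for i by simp
    have PiE: "Pi\<^sub>E UNIV A \<in> sets (Pi\<^sub>M UNIV (\<lambda>_::'n. lborel))"
      by (intro sets_PiM_I_finite) auto
    have "emeasure (density (Pi\<^sub>M UNIV (\<lambda>_. lborel)) (\<lambda>x. \<Prod>i\<in>UNIV. h i (x i))) (Pi\<^sub>E UNIV A)
        = (\<integral>\<^sup>+x. (\<Prod>i\<in>UNIV. h i (x i)) * indicator (Pi\<^sub>E UNIV A) x \<partial>Pi\<^sub>M UNIV (\<lambda>_. lborel))"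
      by (subst emeasure_density) (auto intro!: PiE)
    also have "\<dots> = (\<integral>\<^sup>+x. (\<Prod>i\<in>UNIV. h i (x i) * indicator (A i) (x i)) \<partial>Pi\<^sub>M UNIV (\<lambda>_. lborel))"
      by (intro nn_integral_cong) (auto simp: indicator_def PiE_iff prod.distrib)
    also have "\<dots> = (\<Prod>i\<in>UNIV. \<integral>\<^sup>+x. h i x * indicator (A i) x \<partial>lborel)"
      by (rule L.product_nn_integral_prod) auto
    finally show "emeasure (density (Pi\<^sub>M UNIV (\<lambda>_. lborel)) (\<lambda>x. \<Prod>i\<in>UNIV. h i (x i))) (Pi\<^sub>E UNIV A)
        = (\<Prod>i\<in>UNIV. emeasure (density lborel (h i)) (A i))"
      by (simp add: emeasure_density)
  qed simp
qed

text \<open>Independence says that the joint law on the function space is the product of the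
  marginals, so the law of the vector is first carried over from \<open>real ^ 'n\<close>.\<close>

lemma (in prob_space) indep_vars_product_density:
  fixes Z :: "'a \<Rightarrow> real ^ 'n::finite" and h :: "'n \<Rightarrow> real \<Rightarrow> ennreal"
  assumes [measurable]: "Z \<in> borel_measurable M" "\<And>i. h i \<in> borel_measurable borel"
    and prob: "\<And>i. prob_space (density lborel (h i))"
    and Z: "distr M borel Z = density lborel (\<lambda>y. \<Prod>i\<in>UNIV. h i (y $ i))"
  shows "indep_vars (\<lambda>_. borel) (\<lambda>i \<omega>. Z \<omega> $ i) UNIV"
    and "distributed M lborel (\<lambda>\<omega>. Z \<omega> $ i) (h i)"
proof -
  note [measurable] = measurable_vec_lambda
  let ?B = "Pi\<^sub>M UNIV (\<lambda>_::'n. borel :: real measure)"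
  let ?P = "Pi\<^sub>M UNIV (\<lambda>i. density lborel (h i))"
  have [measurable]: "(\<lambda>y i. y $ i) \<in> measurable (borel :: (real ^ 'n) measure) ?B"
    by (intro measurable_PiM_single') auto
  have "distr M ?B (\<lambda>\<omega> i. Z \<omega> $ i) = distr (distr M borel Z) ?B (\<lambda>y i. y $ i)"
    by (subst distr_distr) (auto simp: comp_def)
  also have "\<dots> = distr (distr (density (Pi\<^sub>M UNIV (\<lambda>_. lborel)) (\<lambda>x. \<Prod>i\<in>UNIV. h i (x i))) borel (\<lambda>x. \<chi> i. x i)) ?B (\<lambda>y i. y $ i)"
    unfolding Z by (subst lborel_vec_eq_distr_PiM, subst density_distr) auto
  also have "\<dots> = distr (density (Pi\<^sub>M UNIV (\<lambda>_. lborel)) (\<lambda>x. \<Prod>i\<in>UNIV. h i (x i))) ?B (\<lambda>x. x)"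
    by (subst distr_distr) (auto simp: comp_def vec_lambda_inverse)
  also have "\<dots> = ?P"
    unfolding density_PiM[OF assms(2) prob]
    by (rule distr_id2) (auto intro!: sets_PiM_cong)
  finally have joint: "distr M ?B (\<lambda>\<omega> i. Z \<omega> $ i) = ?P" .
  have marg: "distr M borel (\<lambda>\<omega>. Z \<omega> $ i) = density lborel (h i)" for i
  proof -
    have "density lborel (h i) = distr ?P (density lborel (h i)) (\<lambda>x. x i)"
      using prob by (intro distr_PiM_component[symmetric]) auto
    also have "\<dots> = distr ?P borel (\<lambda>x. x i)"
      by (intro distr_cong) auto
    also have "\<dots> = distr M borel (\<lambda>\<omega>. Z \<omega> $ i)"
      unfolding joint[symmetric] by (subst distr_distr) (auto simp: comp_def)
    finally show ?thesis by simp
  qed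
  show "indep_vars (\<lambda>_. borel) (\<lambda>i \<omega>. Z \<omega> $ i) UNIV"
    by (subst indep_vars_iff_distr_eq_PiM) (auto simp: restrict_UNIV joint marg)
  have "distr M lborel (\<lambda>\<omega>. Z \<omega> $ i) = distr M borel (\<lambda>\<omega>. Z \<omega> $ i)"
    by (intro distr_cong) auto
  then show "distributed M lborel (\<lambda>\<omega>. Z \<omega> $ i) (h i)"
    unfolding distributed_def by (auto simp: marg)
qed

section \<open>Exponents of the parents of the leaves\<close>

lemma leaves_lp_subtrees: "s \<in> lp_subtrees t \<Longrightarrow> set (leaves s) \<subseteq> set (leaves t)"
  by (induction t) auto

text \<open>The last clause treats a single leaf, whose parent lies outside the tree; one level
  higher it yields the middle clause for the leaves directly below the node.\<close>

definition leaf_exponents :: "'n::finite lp_tree \<Rightarrow> real \<Rightarrow> ('n \<Rightarrow> real) \<Rightarrow> bool" where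
  "leaf_exponents t q e \<longleftrightarrow>
     (\<forall>y. leaf_gauss t q y = (\<Prod>i\<in>set (leaves t). exp (- (\<bar>y $ i\<bar> powr e i) / exponent_scale (e i)))) \<and>
     (\<forall>i p ts. Inner p ts \<in> lp_subtrees t \<longrightarrow> Leaf i \<in> set ts \<longrightarrow> e i = p) \<and>
     (\<forall>i. t = Leaf i \<longrightarrow> e i = q)"

lemma leaf_exponents_cong:
  assumes "leaf_exponents t q e" "\<And>i. i \<in> set (leaves t) \<Longrightarrow> e i = e' i"
  shows "leaf_exponents t q e'"
proof -
  have "i \<in> set (leaves t)" if "Inner p ts \<in> lp_subtrees t" "Leaf i \<in> set ts" for i p ts
    using leaves_lp_subtrees[OF that(1)] that(2) by force
  moreover have "(\<Prod>i\<in>set (leaves t). exp (- (\<bar>y $ i\<bar> powr e i) / exponent_scale (e i)))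
      = (\<Prod>i\<in>set (leaves t). exp (- (\<bar>y $ i\<bar> powr e' i) / exponent_scale (e' i)))" for y :: "real ^ 'a"
    using assms(2) by (intro prod.cong) auto
  ultimately show ?thesis
    using assms unfolding leaf_exponents_def by (metis leaves.simps(1) list.set_intros(1))
qed

text \<open>Since no two children share a leaf, their exponent functions can be merged according to
  which child owns the coordinate.\<close>

lemma leaf_exponents_glue:
  assumes "\<And>t. t \<in> set ts \<Longrightarrow> \<exists>e. leaf_exponents t q e" "distinct (concat (map leaves ts))"
  shows "\<exists>e. \<forall>t\<in>set ts. leaf_exponents t q e"
  using assms
proof (induction ts)
  case (Cons t ts)
  obtain e1 where e1: "leaf_exponents t q e1" using Cons.prems(1)[of t] by auto
  obtain e2 where e2: "\<And>s. s \<in> set ts \<Longrightarrow> leaf_exponents s q e2" using Cons by auto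
  let ?e = "\<lambda>i. if i \<in> set (leaves t) then e1 i else e2 i"
  have "leaf_exponents t q ?e" by (rule leaf_exponents_cong[OF e1]) simp
  moreover have "leaf_exponents s q ?e" if "s \<in> set ts" for s
    by (rule leaf_exponents_cong[OF e2[OF that]]) (use that Cons.prems(2) in auto)
  ultimately show ?case by (intro exI[of _ ?e]) auto
qed simp

lemma prod_list_prod_leaves:
  fixes F :: "'i \<Rightarrow> real"
  assumes "distinct (concat (map leaves ts))"
  shows "(\<Prod>t\<leftarrow>ts. \<Prod>i\<in>set (leaves t). F i) = (\<Prod>i\<in>set (concat (map leaves ts)). F i)"
  using assms
proof (induction ts)
  case (Cons t ts)
  then have "set (leaves t) \<inter> set (concat (map leaves ts)) = {}" by auto
  with Cons show ?case by (simp add: prod.union_disjoint del: set_concat)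
qed simp

lemma ex_leaf_exponents: "proper t \<Longrightarrow> \<exists>e. leaf_exponents t q e"
proof (induction t arbitrary: q)
  case (Leaf i)
  show ?case by (intro exI[of _ "\<lambda>_. q"]) (simp add: leaf_exponents_def)
next
  case (Inner p ts)
  note I = proper_Inner[OF Inner.prems]
  obtain e where e: "\<And>t. t \<in> set ts \<Longrightarrow> leaf_exponents t p e"
    using leaf_exponents_glue[OF Inner.IH[OF _ I(4)] I(3)] by blast
  have "leaf_gauss (Inner p ts) q y
      = (\<Prod>i\<in>set (leaves (Inner p ts)). exp (- (\<bar>y $ i\<bar> powr e i) / exponent_scale (e i)))" for y
  proof -
    have "leaf_gauss (Inner p ts) q y
        = (\<Prod>t\<leftarrow>ts. \<Prod>i\<in>set (leaves t). exp (- (\<bar>y $ i\<bar> powr e i) / exponent_scale (e i)))"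
      unfolding leaf_gauss.simps
      by (intro arg_cong[where f = prod_list] map_cong) (use e in \<open>auto simp: leaf_exponents_def\<close>)
    then show ?thesis
      by (simp only: prod_list_prod_leaves[OF I(3)] leaves.simps)
  qed
  moreover have "e i = p'" if "Inner p' us \<in> lp_subtrees (Inner p ts)" "Leaf i \<in> set us" for i p' us
    using that e unfolding leaf_exponents_def by auto
  ultimately have "leaf_exponents (Inner p ts) q e"
    unfolding leaf_exponents_def by blast
  then show ?case by (intro exI[of _ e])
qed

text \<open>The weight at the root is 1, so this is the condition \<open>finite_ball\<close>
  there.\<close>

lemma nn_integral_lp_unit_ball_finite:
  fixes t :: "'n::finite lp_tree"
  assumes "proper t" "set (leaves t) = UNIV"
  shows "(\<integral>\<^sup>+y. 1 * indicator {y. lp_nested t y \<le> 1} y \<partial>lborel) < \<infinity>"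
proof -
  have "{y. lp_nested t y \<le> 1} \<subseteq> cbox (- 1) 1"
  proof
    fix y assume "y \<in> {y. lp_nested t y \<le> 1}"
    then have "\<bar>y $ i\<bar> \<le> 1" for i
      using abs_le_lp_nested[OF assms(1), of i y] assms(2) by auto
    then show "y \<in> cbox (- 1) 1"
      by (auto simp: mem_box_cart abs_le_iff minus_le_iff)
  qed
  then have "emeasure lborel {y. lp_nested t y \<le> 1} \<le> emeasure lborel (cbox (- 1) (1 :: real ^ 'n))"
    by (intro emeasure_mono) auto
  also have "\<dots> < \<infinity>" by (rule emeasure_lborel_cbox_finite)
  finally show ?thesis by simp
qed

text \<open>Measurability is known for the composite with the nested function, not for
  \<open>g\<close>. Along the ray through the all-ones vector the nested function takes each
  positive value, so the composite on this ray is a measurable profile.\<close>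

lemma lp_nested_profile_measurable:
  fixes t :: "'n::finite lp_tree" and g :: "real \<Rightarrow> real"
  assumes "proper t" and g: "(\<lambda>y. ennreal (g (lp_nested t y))) \<in> borel_measurable lborel"
  obtains G where "G \<in> borel_measurable borel" "\<And>y. ennreal (g (lp_nested t y)) = G (lp_nested t y)"
proof
  let ?b = "1 :: real ^ 'n"
  \<comment> \<open>Stretching \<open>?b\<close> by \<open>r / lp_nested t ?b\<close> produces a
    vector of value \<open>r\<close>; the other branch is reached only at the value 0.\<close>
  let ?G = "\<lambda>r. if r > 0 then ennreal (g (lp_nested t (scale_leaves t (r / lp_nested t ?b) ?b))) else ennreal (g 0)"
  obtain i where "i \<in> set (leaves t)"
    using proper_leaves_nonempty[OF assms(1)] by (cases "leaves t") auto
  then have pos: "lp_nested t ?b > 0"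
    using abs_le_lp_nested[OF assms(1), of i ?b] by simp
  have [measurable]: "(\<lambda>y. ennreal (g (lp_nested t y))) \<in> borel_measurable borel"
    using g by simp
  have "(\<lambda>r. ennreal (g (lp_nested t (scale_leaves t (r / lp_nested t ?b) ?b)))) \<in> borel_measurable borel"
    by (rule measurable_compose[where N = borel and g = "\<lambda>y. ennreal (g (lp_nested t y))"]) measurable
  then show "?G \<in> borel_measurable borel" by measurable
  show "ennreal (g (lp_nested t y)) = ?G (lp_nested t y)" for y
    using pos lp_nested_nonneg[of t y] by (simp add: lp_nested_scale[OF assms(1)])
qed

section \<open>The factorised density at the root\<close>

theorem mainTheorem9:
  fixes M :: "'a measure"
    and t :: "'n::finite lp_tree"
    and \<rho> :: "real \<Rightarrow> real"
    and W :: "real ^ 'n ^ 'n"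
    and X :: "'a \<Rightarrow> real ^ 'n"
  assumes "prob_space M"
    and "CARD('n) \<ge> 2"
    and "lp_tree_wf t"
    and "prob_density_on_pos \<rho>"
    and "invertible W"
    and "X \<in> borel_measurable M"
    and "lp_nested_symmetric M t (\<lambda>\<omega>. W *v X \<omega>)"
    and "has_radial_density M t (\<lambda>\<omega>. W *v X \<omega>) \<rho>"
  shows "prob_space.indep_vars M (\<lambda>_. borel) (\<lambda>i \<omega>. NRF (W *v X \<omega>) t \<rho> $ i) UNIV \<and>
    (\<forall>i p ts. Inner p ts \<in> lp_subtrees t \<and> Leaf i \<in> set ts \<longrightarrow>
       (\<exists>c>0. distributed M lborel (\<lambda>\<omega>. NRF (W *v X \<omega>) t \<rho> $ i)
          (\<lambda>x. ennreal (c * exp (- (\<bar>x\<bar> powr p) / exponent_scale p)))))"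
proof -
  interpret prob_space M by fact
  have proper: "proper t" and UNIV: "set (leaves t) = UNIV"
    using assms(3) by (auto simp: lp_tree_wf_def proper_def)
  obtain p0 ts0 where t: "t = Inner p0 ts0"
  proof (cases t)
    case (Leaf i)
    then have "(UNIV :: 'n set) = {i}" using UNIV by simp
    then have "CARD('n) = card {i}" by (rule arg_cong)
    then show ?thesis using assms(2) by simp
  qed
  define Y where "Y \<omega> = W *v X \<omega>" for \<omega>
  obtain g where g: "distributed M lborel Y (\<lambda>y. ennreal (g (lp_nested t y)))"
    using assms(7) unfolding lp_nested_symmetric_def Y_def by auto
  have Y [measurable]: "Y \<in> borel_measurable M"
    using distributed_measurable[OF g] by simp
  define N where "N = distr M borel Y"
  have probN: "prob_space N" unfolding N_def by (rule prob_space_distr) simp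
  obtain G where G: "G \<in> borel_measurable borel" "\<And>y. ennreal (g (lp_nested t y)) = G (lp_nested t y)"
    using lp_nested_profile_measurable[OF proper distributed_borel_measurable[OF g]] by blast
  have "N = distr M lborel Y" unfolding N_def by (intro distr_cong) auto
  then have N: "N = density lborel (\<lambda>y. G (lp_nested t y) * 1)"
    using distributed_distr_eq_density[OF g] by (simp add: G(2))
  define S where "S = density lborel (\<lambda>r. ennreal (\<rho> r))"
  have S: "distr N borel (lp_nested t) = S"
  proof -
    have "distr N borel (lp_nested t) = distr M borel (\<lambda>\<omega>. lp_nested t (Y \<omega>))"
      unfolding N_def by (subst distr_distr) (auto simp: comp_def)
    also have "\<dots> = distr M lborel (\<lambda>\<omega>. lp_nested t (Y \<omega>))"
      by (intro distr_cong) auto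
    also have "\<dots> = S"
      using assms(8) unfolding has_radial_density_def S_def Y_def by (rule distributed_distr_eq_density)
    finally show ?thesis .
  qed
  have realS: "real_distribution S"
    unfolding S[symmetric] by (rule prob_space.real_distribution_distr[OF probN]) (simp add: N_def)
  have [measurable]: "nrf_rec t S \<in> borel_measurable borel"
    by (rule nrf_rec_measurable[OF proper realS])
  define Z where "Z \<omega> = nrf_rec t S (Y \<omega>)" for \<omega>
  have Z [measurable]: "Z \<in> borel_measurable M" unfolding Z_def by measurable
  have Z_NRF: "NRF (W *v X \<omega>) t \<rho> = Z \<omega>" for \<omega>
    by (simp add: NRF_def Z_def S_def Y_def)
  \<comment> \<open>The exponent 1 given to \<open>leaf_gauss\<close> is a placeholder: the root is
    an inner node and hands its own exponent to its children.\<close>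
  have "\<exists>c>0. distr N borel (nrf_rec t (distr N borel (lp_nested t)))
      = density lborel (\<lambda>y. ennreal (c * leaf_gauss t 1 y) * 1)"
    unfolding t
  proof (rule nrf_rec_Inner)
    show "factorizes s p0" if "s \<in> set ts0" for s
      using proper_Inner[OF proper[unfolded t]] that by (auto intro: factorizes)
    show "ignores (set (leaves (Inner p0 ts0))) (\<lambda>y. 1)" by (simp add: ignores_def)
    show "(\<integral>\<^sup>+y. 1 * indicator {y. lp_nested (Inner p0 ts0) y \<le> 1} y \<partial>lborel) < \<infinity>"
      using nn_integral_lp_unit_ball_finite[OF proper UNIV] unfolding t .
  qed (use G(1) proper N probN t in \<open>simp_all del: lp_nested.simps\<close>)
  then obtain c where c: "c > 0" "distr N borel (nrf_rec t S) = density lborel (\<lambda>y. ennreal (c * leaf_gauss t 1 y))"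
    unfolding S by auto
  have distrZ: "distr M borel Z = density lborel (\<lambda>y. ennreal (c * leaf_gauss t 1 y))"
    unfolding c(2)[symmetric] N_def Z_def by (subst distr_distr) (auto simp: comp_def)
  obtain e where e: "leaf_exponents t 1 e" using ex_leaf_exponents[OF proper] by blast
  define w where "w i x = exp (- (\<bar>x\<bar> powr e i) / exponent_scale (e i))" for i :: 'n and x
  have [measurable]: "w i \<in> borel_measurable borel" for i unfolding w_def by measurable
  have w: "w i x > 0" for i x by (simp add: w_def)
  have lg: "leaf_gauss t 1 y = (\<Prod>i\<in>UNIV. w i (y $ i))" for y
    using e UNIV unfolding leaf_exponents_def w_def by simp
  \<comment> \<open>These integrals are not evaluated: that they are positive and finite follows
    from the total mass one of the joint density.\<close>
  define K where "K i = (\<integral>\<^sup>+x. ennreal (w i x) \<partial>lborel)" for i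
  have "1 = emeasure (distr M borel Z) UNIV"
    using prob_space.emeasure_space_1[OF prob_space_distr[OF Z]] by simp
  also have "\<dots> = (\<integral>\<^sup>+y. ennreal c * (\<Prod>i\<in>UNIV. ennreal (w i (y $ i))) \<partial>lborel)"
    unfolding distrZ using c(1) w
    by (subst emeasure_density) (auto simp: lg ennreal_mult' prod_ennreal less_imp_le)
  also have "\<dots> = ennreal c * (\<Prod>i\<in>UNIV. K i)"
    unfolding K_def by (subst nn_integral_cmult) (auto simp: nn_integral_vec_prod[of "\<lambda>i x. ennreal (w i x)"])
  finally have cK: "ennreal c * (\<Prod>i\<in>UNIV. K i) = 1" by simp
  have prod_K: "(\<Prod>i\<in>UNIV. K i) \<noteq> 0"
    using cK by (metis mult_zero_right zero_neq_one)
  have prod_K': "(\<Prod>i\<in>UNIV. K i) \<noteq> \<infinity>"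
  proof
    assume "(\<Prod>i\<in>UNIV. K i) = \<infinity>"
    with cK have "ennreal c * \<infinity> = 1" by (simp only:)
    then show False using c(1) by (simp add: ennreal_mult_top)
  qed
  \<comment> \<open>Positivity has to come first: in \<open>ennreal\<close> an infinite factor makes
    a product infinite only if no other factor is 0.\<close>
  have K0: "K i \<noteq> 0" for i using prod_K by simp
  moreover have "K i \<noteq> \<infinity>" for i
    using prod_K' K0 by (auto simp: ennreal_prod_eq_top)
  ultimately have "\<exists>r>0. K i = ennreal r" for i
    by (cases "K i") (auto simp: less_le)
  then obtain \<kappa> where \<kappa>: "\<And>i. \<kappa> i > 0" "\<And>i. K i = ennreal (\<kappa> i)" by metis
  have "c * (\<Prod>i\<in>UNIV. \<kappa> i) = 1"
    using cK c(1) \<kappa>(1) by (simp add: \<kappa>(2) prod_ennreal less_imp_le prod_nonneg flip: ennreal_mult)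
  \<comment> \<open>The constant of the joint density splits into one normalising constant per
    coordinate.\<close>
  then have c_eq: "c = (\<Prod>i\<in>UNIV. 1 / \<kappa> i)"
    using \<kappa>(1) by (simp add: prod_dividef divide_simps) (metis less_irrefl mult_zero_right zero_neq_one)
  define h where "h i x = ennreal (1 / \<kappa> i * w i x)" for i x
  have h_meas [measurable]: "h i \<in> borel_measurable borel" for i unfolding h_def by measurable
  have h_prob: "prob_space (density lborel (h i))" for i
  proof (rule prob_spaceI)
    have "h i x = ennreal (1 / \<kappa> i) * ennreal (w i x)" for x
      unfolding h_def using \<kappa>(1)[of i] by (intro ennreal_mult') (simp add: less_imp_le)
    then have "emeasure (density lborel (h i)) UNIV = ennreal (1 / \<kappa> i) * K i"
      unfolding K_def by (subst emeasure_density, simp, simp, subst nn_integral_cmult[symmetric]) simp_all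
    then show "emeasure (density lborel (h i)) (space (density lborel (h i))) = 1"
      using \<kappa>(1)[of i] by (simp add: \<kappa>(2) flip: ennreal_mult)
  qed
  have h_prod: "ennreal (c * leaf_gauss t 1 y) = (\<Prod>i\<in>UNIV. h i (y $ i))" for y
    unfolding h_def c_eq lg prod.distrib[symmetric] using \<kappa>(1) w
    by (subst prod_ennreal) (auto simp: less_imp_le)
  have indep: "indep_vars (\<lambda>_. borel) (\<lambda>i \<omega>. Z \<omega> $ i) UNIV"
    by (rule indep_vars_product_density(1)[OF Z h_meas h_prob]) (simp add: distrZ h_prod)
  have marg: "distributed M lborel (\<lambda>\<omega>. Z \<omega> $ i) (h i)" for i
    by (rule indep_vars_product_density(2)[OF Z h_meas h_prob]) (simp add: distrZ h_prod)
  show ?thesis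
    unfolding Z_NRF
  proof (intro conjI allI impI indep)
    fix i p ts assume "Inner p ts \<in> lp_subtrees t \<and> Leaf i \<in> set ts"
    then have "e i = p" using e unfolding leaf_exponents_def by blast
    then have "h i = (\<lambda>x. ennreal (1 / \<kappa> i * exp (- (\<bar>x\<bar> powr p) / exponent_scale p)))"
      by (simp add: h_def[abs_def] w_def)
    then show "\<exists>c>0. distributed M lborel (\<lambda>\<omega>. Z \<omega> $ i)
        (\<lambda>x. ennreal (c * exp (- (\<bar>x\<bar> powr p) / exponent_scale p)))"
      using marg[of i] \<kappa>(1)[of i] by (intro exI[of _ "1 / \<kappa> i"]) simp
  qed
qed

end
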